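(* Let $d>1$ be a squarefree integer and let $m,n$ be nonzero integers with $m^2-dn^2=4$, $9\nmid m$, $27\nmid (m-2)$, and $\mathrm{ord}_3(m-2)\ge \mathrm{ord}_3 n$, where $\mathrm{ord}_3$ denotes the $3$-adic order. Let $p$ be a prime with $p\nmid n$ and $p=x^2+3dy^2$, where $x,y$ are integers with $3\nmid y$ and $x\equiv y\pmod 3$. Then modulo $p$, $$\Big(\frac{m+n\sqrt d}{2}\Big)^{\frac{p-1}{3}}\equiv \begin{cases} \frac12\Big(-1+\big(\frac{(m-2)n/3}{3}\big)\frac{x}{dy}\sqrt d\Big) & \text{if } m\equiv 5,8\pmod 9,\\ \frac12\Big(-1-\big(\frac{(m-2)n/27}{3}\big)\frac{x}{dy}\sqrt d\Big) & \text{if } m\equiv 11,20\pmod{27},\\ \frac12\Big(-1+\big(\frac{mn/3}{3}\big)\frac{x}{dy}\sqrt d\Big) & \text{if } m\equiv 0\pmod 3,\\ \frac12\Big(-1+\big(\frac{(m+2)n/3}{3}\big)\frac{x}{dy}\sqrt d\Big) & \text{if } m\equiv 1\pmod 3,\end{cases}$$ where $\big(\frac{\cdot}{3}\big)$ is the Legendre symbol.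
   Context: For such a prime $p$, $d$ is a nonzero square modulo $p$. In the congruence, $\sqrt d$ is interpreted as an integer $s$ with $s^2\equiv d\pmod p$, the same choice of $s$ being used on both sides (the congruence holds for either choice), and the denominators $2$ and $dy$, which are prime to $p$, are inverted modulo $p$. *)

theory Defs
  imports "HOL-Number_Theory.Number_Theory" "HOL-Computational_Algebra.Squarefree"
begin

text \<open>
  The following facts justify reading the congruence in terms of
  \<^const>\<open>modular_inverse\<close>, integer division and an integer square root \<open>s\<close> of \<open>d\<close>
  modulo \<open>p\<close>: every denominator is invertible modulo \<open>p\<close>, every integer division is exact,
  and such an \<open>s\<close> exists.
\<close>

context
  fixes d x y :: int and p :: nat
  assumes d: "d > 1"
    and p: "prime p" "int p = x ^ 2 + 3 * d * y ^ 2"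
    and xy: "\<not> 3 dvd y" "[x = y] (mod 3)"
begin

lemma prime_gt_5_d_y: "p > 5" "int p > d" "int p > \<bar>y\<bar>"
proof -
  have y0: "y \<noteq> 0" using xy by auto
  have x0: "x \<noteq> 0" using xy by (auto simp: cong_iff_dvd_diff)
  have x1: "x ^ 2 \<ge> 1" using x0 by (simp add: int_one_le_iff_zero_less)
  have y1: "y ^ 2 \<ge> 1" using y0 by (simp add: int_one_le_iff_zero_less)
  have a: "d * y ^ 2 \<ge> d * 1" using y1 d by (intro mult_left_mono) auto
  have b: "d * y ^ 2 \<ge> 1 * y ^ 2" using d by (intro mult_right_mono) auto
  have c: "y ^ 2 \<ge> \<bar>y\<bar>" using self_le_power[of "\<bar>y\<bar>" 2] y0 by auto
  have e: "int p = x ^ 2 + 3 * (d * y ^ 2)" using p(2) by simp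
  have "int p > 5" using a x1 d e by linarith
  then show "p > 5" by simp
  show "int p > d" using a x1 d e by linarith
  show "int p > \<bar>y\<bar>" using b c x1 e by linarith
qed

lemma denominators_coprime: "coprime 2 (int p)" "coprime (d * y) (int p)"
proof -
  have pr: "prime (int p)" using p(1) by simp
  have *: "coprime k (int p)" if "k \<noteq> 0" "\<bar>k\<bar> < int p" for k
    using that pr zdvd_not_zless[of "\<bar>k\<bar>" "int p"] prime_imp_coprime[OF pr, of k]
    by (auto simp: coprime_commute dest: dvd_imp_le_int)
  show "coprime 2 (int p)" using prime_gt_5_d_y by (intro *) auto
  have "coprime d (int p)" using prime_gt_5_d_y d by (intro *) auto
  moreover have "coprime y (int p)" using prime_gt_5_d_y xy by (intro *) auto
  ultimately show "coprime (d * y) (int p)" by simp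
qed

lemma prime_cong_1_mod_3: "[int p = 1] (mod 3)"
proof -
  have "[int p = y ^ 2 + 0] (mod 3)"
    unfolding p(2) using xy(2) by (intro cong_add cong_pow) (auto simp: cong_0_iff)
  also have "[y ^ 2 + 0 = 1] (mod 3)"
  proof -
    have "y mod 3 = 1 \<or> y mod 3 = 2" using xy(1) by presburger
    then have "(y mod 3) ^ 2 mod 3 = 1" by auto
    then show ?thesis by (simp add: cong_def power_mod)
  qed
  finally show ?thesis .
qed

lemma exponent_exact: "3 dvd p - 1"
proof -
  have "int p mod 3 = 1" using prime_cong_1_mod_3 by (simp add: cong_def)
  then show ?thesis by presburger
qed

lemma sqrt_d_mod_p_exists: "\<exists>s. [s ^ 2 = d] (mod int p)"
proof -
  have pr: "prime (int p)" using p(1) by simp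
  have p5: "2 < p" using prime_gt_5_d_y by simp
  have coprime3: "coprime 3 (int p)"
    using primes_coprime[of 3 "int p"] pr prime_gt_5_d_y(1) by simp
  define h where "h = (p - 1) div 2"
  have L3: "Legendre (int p) 3 = 1"
  proof -
    have "[1 ^ 2 = int p] (mod 3)" using prime_cong_1_mod_3 by (simp add: cong_sym)
    then have "QuadRes 3 (int p)" unfolding QuadRes_def by blast
    moreover have "\<not> [int p = 0] (mod 3)" using prime_cong_1_mod_3 by (simp add: cong_def)
    ultimately show ?thesis by (simp add: Legendre_def)
  qed
  have "Legendre 3 (int p) * Legendre (int p) 3 = (-1) ^ ((3 - 1) div 2 * ((p - 1) div 2))"
    using Quadratic_Reciprocity[of 3 p] p(1) prime_gt_5_d_y(1) by simp
  then have L: "Legendre 3 (int p) = (-1) ^ h" using L3 by (simp add: h_def)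
  have e: "[(-1) ^ h = 3 ^ h] (mod int p)"
    using euler_criterion[OF p(1) p5, of 3] L by (simp add: h_def)
  have "[Legendre (-3) (int p) = (-3) ^ h] (mod int p)"
    using euler_criterion[OF p(1) p5] by (simp add: h_def)
  also have "(-3 :: int) ^ h = (-1) ^ h * 3 ^ h"
    by (metis mult_minus1 power_mult_distrib)
  also have "[(-1) ^ h * 3 ^ h = (-1) ^ h * (-1) ^ h] (mod int p)"
    by (intro cong_mult cong_refl cong_sym[OF e])
  also have "(-1 :: int) ^ h * (-1) ^ h = 1"
    using power_mult_distrib[of "-1 :: int" "-1" h] by simp
  finally have "[Legendre (-3) (int p) = 1] (mod int p)" .
  then have "QuadRes (int p) (-3)"
    using p5 by (auto simp: Legendre_def cong_iff_dvd_diff zdvd_not_zless split: if_splits)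
  then obtain t where t: "[t ^ 2 = -3] (mod int p)" by (auto simp: QuadRes_def)
  have "coprime (t ^ 2) (int p)"
    using cong_imp_coprime[OF cong_sym[OF t]] coprime3 by simp
  then have cop: "coprime (t * y) (int p)" using denominators_coprime(2) by simp
  define i where "i = modular_inverse (int p) (t * y)"
  have i: "[t * y * i = 1] (mod int p)" unfolding i_def using cop by (rule cong_modular_inverse1)
  have "[(x * i) ^ 2 = x ^ 2 * i ^ 2 - int p * i ^ 2] (mod int p)"
    by (simp add: cong_iff_dvd_diff power_mult_distrib)
  also have "x ^ 2 * i ^ 2 - int p * i ^ 2 = -3 * (d * y ^ 2 * i ^ 2)"
    unfolding p(2) by (simp add: algebra_simps)
  also have "[\<dots> = t ^ 2 * (d * y ^ 2 * i ^ 2)] (mod int p)"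
    by (intro cong_mult cong_refl cong_sym[OF t])
  also have "t ^ 2 * (d * y ^ 2 * i ^ 2) = d * (t * y * i) ^ 2"
    by (simp add: power_mult_distrib mult_ac)
  also have "[\<dots> = d * 1 ^ 2] (mod int p)" using i by (intro cong_mult cong_refl cong_pow)
  finally show ?thesis by auto
qed

end

lemma Legendre_arguments_exact:
  fixes d m n :: int
  assumes "squarefree d" and "m ^ 2 - d * n ^ 2 = 4"
  shows "[m = 5] (mod 9) \<or> [m = 8] (mod 9) \<Longrightarrow> 3 dvd (m - 2) * n"
    and "[m = 11] (mod 27) \<or> [m = 20] (mod 27) \<Longrightarrow> 27 dvd (m - 2) * n"
    and "[m = 0] (mod 3) \<Longrightarrow> 3 dvd m * n"
    and "[m = 1] (mod 3) \<Longrightarrow> 3 dvd (m + 2) * n"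
proof -
  show "3 dvd (m - 2) * n" if "[m = 5] (mod 9) \<or> [m = 8] (mod 9)"
  proof -
    have "3 dvd m - 5 \<or> 3 dvd m - 8"
      using that dvd_trans[of 3 9 "m - 5"] dvd_trans[of 3 9 "m - 8"] by (auto simp: cong_iff_dvd_diff)
    then have "3 dvd m - 2" by presburger
    then show ?thesis by simp
  qed
  show "27 dvd (m - 2) * n" if "[m = 11] (mod 27) \<or> [m = 20] (mod 27)"
  proof -
    have "9 dvd m - 11 \<or> 9 dvd m - 20"
      using that dvd_trans[of 9 27 "m - 11"] dvd_trans[of 9 27 "m - 20"] by (auto simp: cong_iff_dvd_diff)
    then have 9: "9 dvd m - 2"
      using dvd_add[of 9 "m - 11" 9] dvd_add[of 9 "m - 20" 18] by auto
    have e: "(m - 2) * (m + 2) = d * n ^ 2"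
      using assms(2) by (simp add: algebra_simps power2_eq_square)
    have "3 ^ 2 dvd d * n ^ 2" using dvd_mult2[OF 9, of "m + 2"] unfolding e by simp
    have "3 dvd n"
    proof (rule ccontr)
      assume "\<not> 3 dvd n"
      then have "coprime (3 ^ 2) (n ^ 2)"
        using prime_imp_coprime[of 3 n]
        by (simp only: coprime_power_left_iff coprime_power_right_iff) simp
      then have "3 ^ 2 dvd d"
        using \<open>3 ^ 2 dvd d * n ^ 2\<close> coprime_dvd_mult_left_iff by blast
      then have "is_unit (3 :: int)" using assms(1) unfolding squarefree_def by blast
      then show False by simp
    qed
    then have "9 * 3 dvd (m - 2) * n" by (rule mult_dvd_mono[OF 9])
    then show ?thesis by simp
  qed
  show "3 dvd m * n" if "[m = 0] (mod 3)" using that by (simp add: cong_0_iff)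
  show "3 dvd (m + 2) * n" if "[m = 1] (mod 3)"
  proof -
    have "3 dvd m - 1" using that by (simp add: cong_iff_dvd_diff)
    then have "3 dvd m + 2" by presburger
    then show ?thesis by simp
  qed
qed

end

theory Submission
  imports Defs "HOL-Number_Theory.Residue_Primitive_Roots" "HOL-Computational_Algebra.Polynomial"
begin

text \<open>
  Let $\epsilon = (m + n \sqrt d) / 2$. Since $\epsilon$ has norm 1, it is, up to a cube, equal to
  $(A + B \sqrt d)^2 (A - B \sqrt d)$ or to its inverse, where $A : B$ is one of $m : n$ and
  $(m \pm 2) : n$ in lowest terms, chosen such that $A$ is divisible by 3 exactly once. As
  $x^2 \equiv - 3 d y^2$ modulo $p$, the element $A + B \sqrt d$ corresponds modulo $p$ to
  $\gamma = B x + A y \sqrt{-3}$, up to the factor $\sqrt d / x$, and $A - B \sqrt d$ to $- \bar\gamma$.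
  Cubic reciprocity (proved with Gauss sums) shows that the
  cubic residue symbol of $\gamma$ at a rational prime $l$ is a character of $l$ modulo the norm of
  $\gamma$. In lowest terms, that norm divides $B^2 p + 3 y^2 (A^2 - d B^2)$, and at the primes other
  than 3 that divide $y$, $B$ or $A^2 - d B^2$ the symbol of $\gamma$ is trivial, because $\gamma$ is
  congruent there to a rational number or to a rational multiple of $\sqrt{-3}$. So the symbol at $p$
  is determined by the value of the character at 3, which depends only on $\gamma$ modulo 9.
\<close>

section \<open>Eisenstein integers\<close>

text \<open>The two halves of the condition on A do different work. Divisibility by 3 makes \<gamma>
  congruent modulo 3 to a rational integer prime to 3. Jacobi sums of cubic characters have the same
  property, so \<gamma> factors into Jacobi sums, their conjugates and rational integers without a
  stray power of \<omega>, and the Gauss sum computation carries over factor by factor. That 9 does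
  not divide A keeps the value of the character at 3 different from 1. The obstacle is the prime 3.
  A symbol at l is a power modulo l, which separates cube roots of unity only for l other than 3, so
  the value at 3 cannot be read off from a symbol; it is recovered from relations between rational
  integers modulo the norm. The signs in the four cases have two sources: in the relation for p the
  factor 3 occurs once, or twice if 3 divides d; and the element built from A and B represents
  either \<epsilon> or its inverse.\<close>

text \<open>$a + b \omega$ with $\omega^2 = - 1 - \omega$ is represented by \<open>Eis a b\<close>.\<close>

datatype eis = Eis (ea: int) (eb: int)

lemma eis_eq_iff: "z = w \<longleftrightarrow> ea z = ea w \<and> eb z = eb w"
  by (cases z; cases w) auto

instantiation eis :: idom
begin

definition "0 = Eis 0 0"
definition "1 = Eis 1 0"
definition "z + w = Eis (ea z + ea w) (eb z + eb w)"
definition "z - w = Eis (ea z - ea w) (eb z - eb w)"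
definition "- z = Eis (- ea z) (- eb z)"
definition "z * w = Eis (ea z * ea w - eb z * eb w) (ea z * eb w + eb z * ea w - eb z * eb w)"

lemma ea_simps [simp]:
  "ea 0 = 0" "ea 1 = 1" "ea (z + w) = ea z + ea w" "ea (z - w) = ea z - ea w" "ea (- z) = - ea z"
  "ea (z * w) = ea z * ea w - eb z * eb w"
  by (simp_all add: zero_eis_def one_eis_def plus_eis_def minus_eis_def uminus_eis_def times_eis_def)

lemma eb_simps [simp]:
  "eb 0 = 0" "eb 1 = 0" "eb (z + w) = eb z + eb w" "eb (z - w) = eb z - eb w" "eb (- z) = - eb z"
  "eb (z * w) = ea z * eb w + eb z * ea w - eb z * eb w"
  by (simp_all add: zero_eis_def one_eis_def plus_eis_def minus_eis_def uminus_eis_def times_eis_def)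

text \<open>Placed inside the instantiation because multiplicativity of the norm is what excludes
  zero divisors.\<close>

definition eis_norm :: "eis \<Rightarrow> int" where
  "eis_norm z = ea z ^ 2 - ea z * eb z + eb z ^ 2"

lemma eis_norm_mult: "eis_norm (z * w) = eis_norm z * eis_norm w"
  by (simp add: eis_norm_def power2_eq_square algebra_simps)

text \<open>Completing the square makes the positive definiteness of the form visible.\<close>

lemma four_eis_norm: "4 * eis_norm z = (2 * ea z - eb z) ^ 2 + 3 * eb z ^ 2"
  by (simp add: eis_norm_def power2_eq_square algebra_simps)

lemma eis_norm_nonneg: "eis_norm z \<ge> 0"
proof -
  have "4 * eis_norm z \<ge> 0" unfolding four_eis_norm by simp
  then show ?thesis by simp
qed

lemma eis_norm_eq_0_iff: "eis_norm z = 0 \<longleftrightarrow> ea z = 0 \<and> eb z = 0"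
proof
  assume "eis_norm z = 0"
  then have *: "(2 * ea z - eb z) ^ 2 + 3 * eb z ^ 2 = 0" using four_eis_norm[of z] by simp
  have "eb z ^ 2 = 0"
    using * zero_le_power2[of "2 * ea z - eb z"] zero_le_power2[of "eb z"] by linarith
  then show "ea z = 0 \<and> eb z = 0" using * by simp
qed (simp add: eis_norm_def)

instance
proof
  fix z w :: eis
  assume "z \<noteq> 0" "w \<noteq> 0"
  then have "eis_norm z * eis_norm w \<noteq> 0"
    by (simp add: eis_norm_eq_0_iff eis_eq_iff)
  then have "eis_norm (z * w) \<noteq> 0" by (simp add: eis_norm_mult)
  then show "z * w \<noteq> 0" unfolding eis_norm_eq_0_iff by (metis ea_simps(1) eb_simps(1))
qed (auto simp: eis_eq_iff algebra_simps)

end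

lemma ea_of_nat [simp]: "ea (of_nat k) = int k" and eb_of_nat [simp]: "eb (of_nat k) = 0"
  by (induction k) auto

lemma ea_of_int [simp]: "ea (of_int k) = k" and eb_of_int [simp]: "eb (of_int k) = 0"
  by (cases k rule: int_diff_cases; simp)+

lemma ea_numeral [simp]: "ea (numeral k) = numeral k" and eb_numeral [simp]: "eb (numeral k) = 0"
  using ea_of_int[of "numeral k"] eb_of_int[of "numeral k"] by (simp_all del: ea_of_int eb_of_int)

lemma of_int_dvd_eis_iff: "of_int k dvd z \<longleftrightarrow> k dvd ea z \<and> k dvd eb z"
proof
  assume "k dvd ea z \<and> k dvd eb z"
  then obtain i j where "ea z = k * i" "eb z = k * j" by (auto elim!: dvdE)
  then have "z = of_int k * Eis i j" by (simp add: eis_eq_iff)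
  then show "of_int k dvd z" by simp
qed (auto elim!: dvdE)

definition omega :: eis where "omega = Eis 0 1"

lemma ea_omega [simp]: "ea omega = 0" and eb_omega [simp]: "eb omega = 1"
  by (simp_all add: omega_def)

lemma omega_square: "omega ^ 2 = - 1 - omega"
  by (simp add: eis_eq_iff power2_eq_square)

lemma omega_cube [simp]: "omega ^ 3 = 1"
  by (simp add: eis_eq_iff power3_eq_cube)

lemma omega_neq_1 [simp]: "omega \<noteq> 1"
  by (simp add: eis_eq_iff)

lemma omega_power_mod: "omega ^ (k mod 3) = omega ^ k"
proof -
  have "omega ^ k = omega ^ (3 * (k div 3) + k mod 3)" by simp
  also have "\<dots> = omega ^ (k mod 3)" by (simp only: power_add power_mult omega_cube) simp
  finally show ?thesis by simp
qed

lemma omega_power_cong: "[j = k] (mod 3) \<Longrightarrow> omega ^ j = omega ^ k"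
  by (metis cong_def omega_power_mod)

lemma eis_cube_eq_1_iff: "z ^ 3 = 1 \<longleftrightarrow> z = 1 \<or> z = omega \<or> z = omega ^ 2"
proof -
  have "z ^ 3 - 1 = (z - 1) * (z - omega) * (z - omega ^ 2)"
    by (simp add: omega_square) (simp add: eis_eq_iff power3_eq_cube algebra_simps)
  then show ?thesis by (metis eq_iff_diff_eq_0 mult_eq_0_iff)
qed

definition eis_cnj :: "eis \<Rightarrow> eis" where "eis_cnj z = Eis (ea z - eb z) (- eb z)"

lemma ea_cnj [simp]: "ea (eis_cnj z) = ea z - eb z" and eb_cnj [simp]: "eb (eis_cnj z) = - eb z"
  by (simp_all add: eis_cnj_def)

lemma eis_cnj_simps [simp]:
  "eis_cnj (z + w) = eis_cnj z + eis_cnj w" "eis_cnj (z - w) = eis_cnj z - eis_cnj w" "eis_cnj (z * w) = eis_cnj z * eis_cnj w"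
  "eis_cnj 0 = 0" "eis_cnj 1 = 1" "eis_cnj (- z) = - eis_cnj z" "eis_cnj (of_int k) = of_int k"
  "eis_cnj (eis_cnj z) = z"
  by (auto simp: eis_eq_iff algebra_simps)

lemma eis_cnj_power [simp]: "eis_cnj (z ^ k) = eis_cnj z ^ k"
  by (induction k) auto

lemma eis_cnj_sum [simp]: "eis_cnj (sum f A) = (\<Sum>x\<in>A. eis_cnj (f x))"
  by (induction A rule: infinite_finite_induct) auto

lemma eis_cnj_omega: "eis_cnj omega = omega ^ 2"
  by (simp add: eis_eq_iff power2_eq_square)

lemma mult_cnj: "z * eis_cnj z = of_int (eis_norm z)"
  by (simp add: eis_eq_iff eis_norm_def power2_eq_square algebra_simps)

lemma eis_cnj_cube_root: "z ^ 3 = 1 \<Longrightarrow> eis_cnj z = z ^ 2"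
  unfolding eis_cube_eq_1_iff by (auto simp: eis_cnj_omega)

lemma eis_norm_cnj [simp]: "eis_norm (eis_cnj z) = eis_norm z"
  by (simp add: eis_norm_def power2_eq_square algebra_simps)

lemma eis_norm_of_int [simp]: "eis_norm (of_int k) = k ^ 2"
  by (simp add: eis_norm_def)

text \<open>Distinct cube roots of unity differ by an element of norm 3, whereas the norm of a
  multiple of l is divisible by l^2. This turns congruences between character values into
  equalities.\<close>

lemma cube_roots_cong_imp_eq:
  fixes z w :: eis
  assumes "z ^ 3 = 1" "w ^ 3 = 1" "of_int l dvd z - w" "prime l" "l \<noteq> 3"
  shows "z = w"
proof (rule ccontr)
  assume "z \<noteq> w"
  then have "eis_norm (z - w) = 3"
    using assms(1,2) by (auto simp: eis_cube_eq_1_iff eis_norm_def power2_eq_square)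
  moreover have "l ^ 2 dvd eis_norm (z - w)"
    using assms(3) by (auto simp only: eis_norm_mult eis_norm_of_int dvd_triv_left elim!: dvdE)
  ultimately have "l dvd 3" by (metis dvd_mult_left power2_eq_square)
  moreover have "prime (3::int)" by simp
  ultimately show False using assms(4,5) primes_dvd_imp_eq by blast
qed

section \<open>Congruences in a commutative ring and the Frobenius map\<close>

definition ring_cong :: "'a::comm_ring_1 \<Rightarrow> 'a \<Rightarrow> 'a \<Rightarrow> bool" where
  "ring_cong m a b \<longleftrightarrow> m dvd a - b"

lemma ring_cong_refl [simp]: "ring_cong m a a"
  by (simp add: ring_cong_def)

lemma ring_cong_sym: "ring_cong m a b \<Longrightarrow> ring_cong m b a"
  by (metis dvd_minus_iff minus_diff_eq ring_cong_def)

lemma ring_cong_trans [trans]: "ring_cong m a b \<Longrightarrow> ring_cong m b c \<Longrightarrow> ring_cong m a c"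
  unfolding ring_cong_def using dvd_add[of m "a - b" "b - c"] by simp

lemma ring_cong_add: "ring_cong m a b \<Longrightarrow> ring_cong m c d \<Longrightarrow> ring_cong m (a + c) (b + d)"
  unfolding ring_cong_def using dvd_add[of m "a - b" "c - d"] by (simp add: algebra_simps)

lemma ring_cong_diff: "ring_cong m a b \<Longrightarrow> ring_cong m c d \<Longrightarrow> ring_cong m (a - c) (b - d)"
  unfolding ring_cong_def using dvd_diff[of m "a - b" "c - d"] by (simp add: algebra_simps)

lemma ring_cong_mult: "ring_cong m a b \<Longrightarrow> ring_cong m c d \<Longrightarrow> ring_cong m (a * c) (b * d)"
  unfolding ring_cong_def
  using dvd_add[OF dvd_mult2[of m "a - b" c] dvd_mult[of m "c - d" b]] by (simp add: algebra_simps)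

lemma ring_cong_power: "ring_cong m a b \<Longrightarrow> ring_cong m (a ^ k) (b ^ k)"
  by (induction k) (auto intro: ring_cong_mult)

lemma ring_cong_sum: "(\<And>x. x \<in> A \<Longrightarrow> ring_cong m (f x) (g x)) \<Longrightarrow> ring_cong m (sum f A) (sum g A)"
  by (induction A rule: infinite_finite_induct) (auto intro: ring_cong_add)

text \<open>The ring is left arbitrary because the intended application is to polynomials over
  \<open>eis\<close>.\<close>

lemma freshman_ring_cong:
  assumes "prime (l::nat)"
  shows "ring_cong (of_nat l) ((a + b) ^ l) (a ^ l + b ^ l)"
proof -
  have l: "l > 0" using assms prime_gt_0_nat by blast
  have "(a + b) ^ l = (\<Sum>k\<le>l. of_nat (l choose k) * a ^ k * b ^ (l - k))"
    by (rule binomial_ring)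
  also have "{..l} = insert 0 (insert l {0<..<l})" using l by auto
  also have "(\<Sum>k\<in>\<dots>. of_nat (l choose k) * a ^ k * b ^ (l - k)) =
      b ^ l + (a ^ l + (\<Sum>k\<in>{0<..<l}. of_nat (l choose k) * a ^ k * b ^ (l - k)))"
    using l by simp
  finally have "(a + b) ^ l - (a ^ l + b ^ l) = (\<Sum>k\<in>{0<..<l}. of_nat (l choose k) * a ^ k * b ^ (l - k))"
    by simp
  moreover have "of_nat l dvd (of_nat (l choose k) :: 'a)" if "k \<in> {0<..<l}" for k
    using dvd_choose_prime[of k l] assms that by (auto elim!: dvdE)
  ultimately show ?thesis unfolding ring_cong_def by (auto intro!: dvd_sum dvd_mult2)
qed

lemma freshman_sum_ring_cong:
  assumes "prime (l::nat)"
  shows "ring_cong (of_nat l) ((\<Sum>x\<in>A. f x) ^ l) (\<Sum>x\<in>A. f x ^ l)"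
proof (induction A rule: infinite_finite_induct)
  case (insert x A)
  show ?case
    using ring_cong_trans[OF freshman_ring_cong[OF assms] ring_cong_add[OF ring_cong_refl insert.IH]] insert.hyps
    by simp
qed (use assms prime_gt_0_nat[of l] in \<open>auto simp: power_0_left\<close>)

section \<open>The group ring of a cyclic group\<close>

text \<open>The coefficient of $X$ after reduction modulo $X^q - 1$.\<close>

definition cyclic_coeff :: "nat \<Rightarrow> 'a::comm_ring_1 poly \<Rightarrow> 'a" where
  "cyclic_coeff q P = (\<Sum>j\<le>degree P. coeff P (1 + q * j))"

lemma cyclic_coeff_eq:
  assumes "q > 0" "degree P \<le> n"
  shows "cyclic_coeff q P = (\<Sum>j\<le>n. coeff P (1 + q * j))"
  unfolding cyclic_coeff_def
proof (rule sum.mono_neutral_left)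
  show "\<forall>j\<in>{..n} - {..degree P}. coeff P (1 + q * j) = 0"
  proof
    fix j assume "j \<in> {..n} - {..degree P}"
    then have "degree P < j" by auto
    also have "j \<le> 1 + q * j" using assms(1) by (cases q) auto
    finally show "coeff P (1 + q * j) = 0" by (rule coeff_eq_0)
  qed
qed (use assms in auto)

lemma cyclic_coeff_diff:
  assumes "q > 0"
  shows "cyclic_coeff q (P - Q) = cyclic_coeff q P - cyclic_coeff q Q"
proof -
  define n where "n = max (degree P) (degree Q)"
  have "degree (P - Q) \<le> n" unfolding n_def by (rule degree_diff_le_max)
  then show ?thesis
    using assms by (simp add: cyclic_coeff_eq[of q _ n] n_def sum_subtractf)
qed

lemma cyclic_coeff_smult:
  assumes "q > 0"
  shows "cyclic_coeff q (smult c P) = c * cyclic_coeff q P"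
  using assms degree_smult_le[of c P]
  by (simp add: cyclic_coeff_eq[of q _ "degree P"] sum_distrib_left)

text \<open>Multiplication by X^q shifts the sampled coefficients of K by one place, so the
  difference telescopes to a coefficient of K beyond its degree. Hence \<open>cyclic_coeff q\<close>
  is well defined modulo X^q - 1.\<close>

lemma cyclic_coeff_dvd:
  assumes "q > 1" "monom 1 q - 1 dvd P"
  shows "cyclic_coeff q P = 0"
proof -
  obtain K where K: "P = monom 1 q * K - K"
    using assms(2) by (auto elim!: dvdE simp: algebra_simps)
  define n where "n = degree (monom 1 q * K) + degree K"
  have "cyclic_coeff q P = (\<Sum>j\<le>n. coeff (monom 1 q * K) (1 + q * j)) - (\<Sum>j\<le>n. coeff K (1 + q * j))"
    unfolding K using assms(1) by (simp add: cyclic_coeff_diff cyclic_coeff_eq[of q _ n] n_def)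
  also have "(\<Sum>j\<le>n. coeff (monom 1 q * K) (1 + q * j)) =
      (\<Sum>j\<le>n. if j = 0 then 0 else coeff K (1 + q * (j - 1)))"
  proof (intro sum.cong refl)
    fix j show "coeff (monom 1 q * K) (1 + q * j) = (if j = 0 then 0 else coeff K (1 + q * (j - 1)))"
      using assms(1) by (cases j) (auto simp: coeff_monom_mult)
  qed
  also have "\<dots> - (\<Sum>j\<le>n. coeff K (1 + q * j)) = - coeff K (1 + q * n)"
  proof -
    have *: "(\<Sum>j\<le>n. if j = 0 then 0 else coeff K (1 + q * (j - 1))) + coeff K (1 + q * n) =
        (\<Sum>j\<le>n. coeff K (1 + q * j))"
      by (induction n) auto
    show ?thesis unfolding *[symmetric] by simp
  qed
  also have "coeff K (1 + q * n) = 0"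
  proof (rule coeff_eq_0)
    have "degree K \<le> n" by (simp add: n_def)
    also have "n < 1 + q * n" using assms(1) by (cases q) auto
    finally show "degree K < 1 + q * n" .
  qed
  finally show ?thesis by simp
qed

text \<open>X takes the place of a primitive q-th root of unity. Gauss sums then live in polynomials
  over \<open>eis\<close> modulo X^q - 1, and no larger number ring has to be constructed. The price
  is that 1 + X + ... + X^(q-1) does not vanish.\<close>

definition group_ring :: "nat \<Rightarrow> (int \<Rightarrow> 'a::comm_ring_1) \<Rightarrow> 'a poly" where
  "group_ring q f = (\<Sum>t\<in>{0..<int q}. monom (f t) (nat t))"

definition periodic :: "nat \<Rightarrow> (int \<Rightarrow> 'a) \<Rightarrow> bool" where
  "periodic q f \<longleftrightarrow> (\<forall>a b. [a = b] (mod int q) \<longrightarrow> f a = f b)"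

lemma periodicD: "periodic q f \<Longrightarrow> [a = b] (mod int q) \<Longrightarrow> f a = f b"
  by (simp add: periodic_def)

lemma sum_reindex_mod:
  assumes "q > 0" "periodic q h"
    "\<And>a b. [a = b] (mod int q) \<Longrightarrow> [u a = u b] (mod int q)"
    "\<And>a b. [a = b] (mod int q) \<Longrightarrow> [v a = v b] (mod int q)"
    "\<And>a. [u (v a) = a] (mod int q)" "\<And>a. [v (u a) = a] (mod int q)"
  shows "(\<Sum>t\<in>{0..<int q}. h (u t)) = (\<Sum>t\<in>{0..<int q}. h t)"
proof (rule sum.reindex_bij_witness[where i = "\<lambda>t. v t mod int q" and j = "\<lambda>t. u t mod int q"])
  fix a assume a: "a \<in> {0..<int q}"
  have "[v (u a mod int q) = v (u a)] (mod int q)" by (rule assms(4)) simp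
  with assms(6)[of a] have "[v (u a mod int q) = a] (mod int q)" by (rule cong_trans[rotated])
  then show "v (u a mod int q) mod int q = a" using a by (simp add: cong_def)
  have "[u (v a mod int q) = u (v a)] (mod int q)" by (rule assms(3)) simp
  with assms(5)[of a] have "[u (v a mod int q) = a] (mod int q)" by (rule cong_trans[rotated])
  then show "u (v a mod int q) mod int q = a" using a by (simp add: cong_def)
  show "h (u a mod int q) = h (u a)" by (rule periodicD[OF assms(2)]) simp
qed (use assms(1) in auto)

lemma sum_reindex_minus:
  "q > 0 \<Longrightarrow> periodic q h \<Longrightarrow> (\<Sum>t\<in>{0..<int q}. h (c - t)) = (\<Sum>t\<in>{0..<int q}. h t)"
  by (rule sum_reindex_mod[where u = "\<lambda>t. c - t" and v = "\<lambda>t. c - t"])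
     (simp_all add: cong_diff)

lemma sum_reindex_mult:
  assumes "q > 0" "periodic q h" "[c * d = 1] (mod int q)"
  shows "(\<Sum>t\<in>{0..<int q}. h (c * t)) = (\<Sum>t\<in>{0..<int q}. h t)"
proof (rule sum_reindex_mod[where u = "\<lambda>t. c * t" and v = "\<lambda>t. d * t"])
  fix a show "[c * (d * a) = a] (mod int q)" "[d * (c * a) = a] (mod int q)"
    using cong_mult[OF assms(3) cong_refl[of a]] by (simp_all add: ac_simps)
qed (simp_all add: assms(1,2) cong_mult)

lemma monom_mod_ring_cong: "ring_cong (monom 1 q - 1) (monom c k) (monom c (k mod q))"
proof -
  have "monom c k = monom c (k mod q) * monom 1 q ^ (k div q)"
    by (simp add: mult_monom monom_power)
  also have "ring_cong (monom 1 q - 1) \<dots> (monom c (k mod q) * 1 ^ (k div q))"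
    by (intro ring_cong_mult ring_cong_power ring_cong_refl) (simp add: ring_cong_def)
  finally show ?thesis by simp
qed

text \<open>Exponents matter only modulo q, and for fixed s the substitution c = s + t turns the
  double sum into a convolution.\<close>

lemma group_ring_mult:
  assumes "q > 0" "periodic q f" "periodic q g"
  shows "ring_cong (monom 1 q - 1) (group_ring q f * group_ring q g)
           (group_ring q (\<lambda>c. \<Sum>t\<in>{0..<int q}. f t * g (c - t)))"
proof -
  have "group_ring q f * group_ring q g =
      (\<Sum>s\<in>{0..<int q}. \<Sum>t\<in>{0..<int q}. monom (f s * g t) (nat s + nat t))"
    unfolding group_ring_def by (simp add: sum_product mult_monom)
  also have "ring_cong (monom 1 q - 1) \<dots>
      (\<Sum>s\<in>{0..<int q}. \<Sum>t\<in>{0..<int q}. monom (f s * g t) ((nat s + nat t) mod q))"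
    by (intro ring_cong_sum monom_mod_ring_cong)
  also have "(\<Sum>s\<in>{0..<int q}. \<Sum>t\<in>{0..<int q}. monom (f s * g t) ((nat s + nat t) mod q)) =
      (\<Sum>s\<in>{0..<int q}. \<Sum>c\<in>{0..<int q}. monom (f s * g (c - s)) (nat c))"
  proof (rule sum.cong[OF refl])
    fix s assume s: "s \<in> {0..<int q}"
    define h where "h = (\<lambda>c. monom (f s * g (c - s)) (nat (c mod int q)))"
    have "periodic q h" unfolding h_def periodic_def
      using periodicD[OF assms(3)] by (metis cong_def cong_diff cong_refl)
    then have "(\<Sum>t\<in>{0..<int q}. h (s + t)) = (\<Sum>t\<in>{0..<int q}. h t)"
      using assms(1)
      by (intro sum_reindex_mod[where u = "\<lambda>t. s + t" and v = "\<lambda>t. t - s"])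
         (simp_all add: cong_diff cong_add)
    moreover have "nat s + nat t = nat (s + t)" "nat ((s + t) mod int q) = nat (s + t) mod q"
      if "t \<in> {0..<int q}" for t
      using that s by (auto simp: nat_mod_distrib nat_add_distrib)
    ultimately show "(\<Sum>t\<in>{0..<int q}. monom (f s * g t) ((nat s + nat t) mod q)) =
        (\<Sum>c\<in>{0..<int q}. monom (f s * g (c - s)) (nat c))"
      by (simp add: h_def)
  qed
  also have "\<dots> = group_ring q (\<lambda>c. \<Sum>t\<in>{0..<int q}. f t * g (c - t))"
    unfolding group_ring_def monom_sum by (rule sum.swap)
  finally show ?thesis .
qed

lemma cyclic_coeff_group_ring:
  assumes "q > 1"
  shows "cyclic_coeff q (group_ring q f) = f 1"
proof -
  have *: "coeff (group_ring q f) k = (if k < q then f (int k) else 0)" for k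
  proof -
    have "coeff (group_ring q f) k = (\<Sum>t\<in>{0..<int q}. coeff (monom (f t) (nat t)) k)"
      unfolding group_ring_def by (simp add: coeff_sum)
    also have "\<dots> = (\<Sum>t\<in>{0..<int q}. if t = int k then f t else 0)"
      by (intro sum.cong) auto
    finally show ?thesis by auto
  qed
  have "(\<Sum>j\<le>n. coeff (group_ring q f) (1 + q * j)) = (\<Sum>j\<le>n. if j = 0 then f 1 else 0)" for n
    using assms by (intro sum.cong refl) (auto simp: * gr0_conv_Suc)
  then show ?thesis by (simp add: cyclic_coeff_def)
qed

lemma group_ring_smult: "group_ring q (\<lambda>t. c * f t) = smult c (group_ring q f)"
proof -
  have "smult c (sum P A) = (\<Sum>t\<in>A. smult c (P t))" for A :: "int set" and P
    by (induction A rule: infinite_finite_induct) (auto simp: smult_add_right)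
  then show ?thesis unfolding group_ring_def by (simp add: smult_monom)
qed

section \<open>Cubic Gauss sums\<close>

lemma ring_cong_smult: "ring_cong m a b \<Longrightarrow> ring_cong m (smult c a) (smult c b)"
  unfolding ring_cong_def by (metis dvd_smult smult_diff_right)

lemma prime_square_mod_3:
  assumes "prime (l::nat)" "l \<noteq> 3"
  shows "l ^ 2 = 3 * ((l ^ 2 - 1) div 3) + 1"
proof -
  have "prime (3::nat)" by simp
  then have "\<not> 3 dvd l" using assms primes_dvd_imp_eq by blast
  then have "l mod 3 = 1 \<or> l mod 3 = 2" by presburger
  then have "(l mod 3) ^ 2 mod 3 = 1" by auto
  then have "l ^ 2 mod 3 = 1" by (simp add: power_mod)
  then show ?thesis by presburger
qed

locale cubic_character =
  fixes q :: nat and \<chi> :: "int \<Rightarrow> eis"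
  assumes prime_q: "prime q"
    and periodic: "periodic q \<chi>"
    and mult: "\<chi> (a * b) = \<chi> a * \<chi> b"
    and zero: "int q dvd a \<Longrightarrow> \<chi> a = 0"
    and cube: "\<not> int q dvd a \<Longrightarrow> \<chi> a ^ 3 = 1"
    and nontrivial: "\<exists>g. \<not> int q dvd g \<and> \<chi> g \<noteq> 1"
begin

definition jacobi_sum :: eis where
  "jacobi_sum = (\<Sum>t\<in>{0..<int q}. \<chi> t * \<chi> (1 - t))"

lemma q_gt_1: "q > 1"
  using prime_q prime_gt_1_nat by blast

lemma chi_cong: "[a = b] (mod int q) \<Longrightarrow> \<chi> a = \<chi> b"
  using periodic by (rule periodicD)

lemma chi_1 [simp]: "\<chi> 1 = 1"
proof -
  have "\<not> int q dvd 1" using q_gt_1 by simp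
  then have "\<chi> 1 ^ 3 = 1" by (rule cube)
  then have "\<chi> 1 \<noteq> 0" by auto
  then show ?thesis using mult[of 1 1] by simp
qed

lemma chi_minus_1 [simp]: "\<chi> (-1) = 1"
proof -
  have "\<not> int q dvd -1" using q_gt_1 by simp
  then have "\<chi> (-1) ^ 3 = 1" by (rule cube)
  moreover have "\<chi> (-1) ^ 2 = 1" using mult[of "-1" "-1"] by (simp add: power2_eq_square)
  ultimately show ?thesis by (simp add: power3_eq_cube power2_eq_square)
qed

lemma chi_minus [simp]: "\<chi> (- a) = \<chi> a"
  using mult[of "-1" a] by simp

lemma eis_cnj_chi: "eis_cnj (\<chi> a) = \<chi> a ^ 2"
  using zero[of a] cube[of a] eis_cnj_cube_root[of "\<chi> a"] by (cases "int q dvd a") auto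

lemma chi_mult_cnj: "eis_cnj (\<chi> a) * \<chi> a = (if int q dvd a then 0 else 1)"
  using zero[of a] cube[of a] by (auto simp: eis_cnj_chi power3_eq_cube power2_eq_square)

lemma inverse_exists:
  assumes "\<not> int q dvd c"
  obtains d where "[c * d = 1] (mod int q)"
proof -
  have "coprime c (int q)"
    using assms prime_q prime_imp_coprime[of "int q" c] by (simp add: coprime_commute)
  then show ?thesis using that cong_solve_coprime_int by blast
qed

lemma sum_chi: "(\<Sum>t\<in>{0..<int q}. \<chi> t) = 0"
proof -
  obtain g where g: "\<not> int q dvd g" "\<chi> g \<noteq> 1" using nontrivial by blast
  obtain d where d: "[g * d = 1] (mod int q)" using inverse_exists[OF g(1)] .
  have "(\<Sum>t\<in>{0..<int q}. \<chi> (g * t)) = (\<Sum>t\<in>{0..<int q}. \<chi> t)"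
    using q_gt_1 by (intro sum_reindex_mult[OF _ periodic d]) simp
  then have "\<chi> g * (\<Sum>t\<in>{0..<int q}. \<chi> t) = (\<Sum>t\<in>{0..<int q}. \<chi> t)"
    by (simp add: mult sum_distrib_left)
  then have "(\<chi> g - 1) * (\<Sum>t\<in>{0..<int q}. \<chi> t) = 0" by (simp add: algebra_simps)
  then show ?thesis using g(2) by simp
qed

lemma sum_chi_minus: "(\<Sum>t\<in>{0..<int q}. \<chi> (c - t)) = 0"
  using sum_reindex_minus[OF _ periodic, of c] q_gt_1 sum_chi by simp

lemma sum_cnj_chi: "(\<Sum>t\<in>{0..<int q}. eis_cnj (\<chi> t)) = 0"
  using arg_cong[OF sum_chi, of eis_cnj] by simp

lemma periodic_cnj: "periodic q (\<lambda>t. eis_cnj (\<chi> t))"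
  using periodic unfolding periodic_def by metis

lemma periodic_mult_minus:
  "periodic q f \<Longrightarrow> periodic q g \<Longrightarrow> periodic q (\<lambda>t. (f t :: eis) * g (c - t))"
  unfolding periodic_def by (metis cong_diff cong_refl)

text \<open>For c prime to q, scaling t by c extracts \<chi>(c)^2, the conjugate of \<chi>(c). For c
  divisible by q the sum is that of the conjugate character, which vanishes.\<close>

lemma chi_conv_chi:
  "(\<Sum>t\<in>{0..<int q}. \<chi> t * \<chi> (c - t)) = jacobi_sum * eis_cnj (\<chi> c)"
proof (cases "int q dvd c")
  case True
  have "\<chi> (c - t) = \<chi> t" for t
  proof -
    have "\<chi> (c - t) = \<chi> (- t)" using True by (intro chi_cong) (simp add: cong_iff_dvd_diff)
    then show ?thesis by simp
  qed
  then have "(\<Sum>t\<in>{0..<int q}. \<chi> t * \<chi> (c - t)) = (\<Sum>t\<in>{0..<int q}. eis_cnj (\<chi> t))"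
    by (simp add: eis_cnj_chi power2_eq_square)
  then show ?thesis using True sum_cnj_chi by (simp add: zero)
next
  case False
  obtain d where d: "[c * d = 1] (mod int q)" using inverse_exists[OF False] .
  have "(\<Sum>t\<in>{0..<int q}. \<chi> t * \<chi> (c - t)) = (\<Sum>t\<in>{0..<int q}. \<chi> (c * t) * \<chi> (c - c * t))"
    using sum_reindex_mult[OF _ periodic_mult_minus[OF periodic periodic] d] q_gt_1 by simp
  also have "\<dots> = (\<Sum>t\<in>{0..<int q}. eis_cnj (\<chi> c) * (\<chi> t * \<chi> (1 - t)))"
  proof (intro sum.cong refl)
    fix t
    have "\<chi> (c - c * t) = \<chi> c * \<chi> (1 - t)" using mult[of c "1 - t"] by (simp add: algebra_simps)
    then show "\<chi> (c * t) * \<chi> (c - c * t) = eis_cnj (\<chi> c) * (\<chi> t * \<chi> (1 - t))"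
      by (simp add: mult eis_cnj_chi power2_eq_square ac_simps)
  qed
  finally show ?thesis by (simp add: jacobi_sum_def flip: sum_distrib_left)
qed

text \<open>The Ramanujan sum modulo q. As a group ring element it is q - (1 + X + ... + X^(q-1)),
  the substitute for the number q in the classical identity for a Gauss sum times its conjugate.
  Because the values of \<chi> sum to 0, it acts on multiples of the Gauss sum as the scalar
  q.\<close>

definition ramanujan :: "int \<Rightarrow> eis" where
  "ramanujan c = (if int q dvd c then of_nat q else 0) - 1"

lemma periodic_ramanujan: "periodic q ramanujan"
  by (auto simp: periodic_def ramanujan_def cong_dvd_iff)

lemma sum_units: "(\<Sum>t\<in>{0..<int q}. if int q dvd t then 0 else c) = of_nat (q - 1) * (c::eis)"
proof -
  have "(\<Sum>t\<in>{0..<int q}. if int q dvd t then 0 else c) = (\<Sum>t\<in>{0..<int q} - {0}. c)"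
    using zdvd_not_zless by (intro sum.mono_neutral_cong_right) auto
  then show ?thesis using q_gt_1 by simp
qed

text \<open>Scaling shows that the convolution is constant on c prime to q. At c = 0 it is q - 1,
  and its total over all c is 0, so the constant must be -1.\<close>

lemma eis_cnj_chi_conv_chi:
  "(\<Sum>t\<in>{0..<int q}. eis_cnj (\<chi> t) * \<chi> (c - t)) = ramanujan c"
proof -
  define K where "K = (\<lambda>c. \<Sum>t\<in>{0..<int q}. eis_cnj (\<chi> t) * \<chi> (c - t))"
  have K0: "K c = of_nat (q - 1)" if "int q dvd c" for c
  proof -
    have "\<chi> (c - t) = \<chi> t" for t
    proof -
      have "\<chi> (c - t) = \<chi> (- t)" using that by (intro chi_cong) (simp add: cong_iff_dvd_diff)
      then show ?thesis by simp
    qed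
    then show ?thesis using sum_units[of 1] by (simp add: K_def chi_mult_cnj)
  qed
  have K1: "K c = K 1" if c: "\<not> int q dvd c" for c
  proof -
    obtain d where d: "[c * d = 1] (mod int q)" using inverse_exists[OF c] .
    have "K c = (\<Sum>t\<in>{0..<int q}. eis_cnj (\<chi> (c * t)) * \<chi> (c - c * t))"
      using sum_reindex_mult[OF _ periodic_mult_minus[OF periodic_cnj periodic] d] q_gt_1
      by (simp add: K_def)
    also have "\<dots> = K 1"
      unfolding K_def
    proof (intro sum.cong refl)
      fix t
      have "\<chi> (c - c * t) = \<chi> c * \<chi> (1 - t)" using mult[of c "1 - t"] by (simp add: algebra_simps)
      then have "eis_cnj (\<chi> (c * t)) * \<chi> (c - c * t) = (eis_cnj (\<chi> c) * \<chi> c) * (eis_cnj (\<chi> t) * \<chi> (1 - t))"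
        by (simp add: mult ac_simps)
      then show "eis_cnj (\<chi> (c * t)) * \<chi> (c - c * t) = eis_cnj (\<chi> t) * \<chi> (1 - t)"
        using that by (simp add: chi_mult_cnj)
    qed
    finally show ?thesis .
  qed
  have "(\<Sum>c\<in>{0..<int q}. K c) = (\<Sum>t\<in>{0..<int q}. eis_cnj (\<chi> t) * (\<Sum>c\<in>{0..<int q}. \<chi> (c - t)))"
    unfolding K_def by (subst sum.swap) (simp add: sum_distrib_left)
  also have "(\<lambda>t. \<Sum>c\<in>{0..<int q}. \<chi> (c - t)) = (\<lambda>t. 0)"
  proof
    fix t
    have "\<chi> (c - t) = \<chi> (t - c)" for c using chi_minus[of "t - c"] by simp
    then show "(\<Sum>c\<in>{0..<int q}. \<chi> (c - t)) = 0" using sum_chi_minus[of t] by simp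
  qed
  finally have "(\<Sum>c\<in>{0..<int q}. K c) = 0" by simp
  moreover have "(\<Sum>c\<in>{0..<int q}. K c) = K 0 + (\<Sum>c\<in>{0..<int q} - {0}. K c)"
    using q_gt_1 by (intro sum.remove) auto
  moreover have "(\<Sum>c\<in>{0..<int q} - {0}. K c) = (\<Sum>c\<in>{0..<int q} - {0}. K 1)"
    using zdvd_not_zless by (intro sum.cong refl K1) auto
  ultimately have "of_nat (q - 1) + of_nat (q - 1) * K 1 = 0"
    using K0[of 0] q_gt_1 by simp
  then have "of_nat (q - 1) * (1 + K 1) = 0" by (simp add: algebra_simps)
  moreover have "(of_nat (q - 1) :: eis) \<noteq> 0" using q_gt_1 by (simp add: eis_eq_iff)
  ultimately have "K 1 = -1" by (metis add.commute add_eq_0_iff mult_eq_0_iff)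
  then have "K c = ramanujan c"
    using K0[of c] K1[of c] q_gt_1 by (auto simp: ramanujan_def of_nat_diff)
  then show ?thesis by (simp add: K_def)
qed

lemma chi_conv_ramanujan:
  "(\<Sum>t\<in>{0..<int q}. \<chi> t * ramanujan (c - t)) = of_nat q * \<chi> c"
proof -
  have "(\<Sum>t\<in>{0..<int q}. \<chi> t * ramanujan (c - t)) =
      (\<Sum>t\<in>{0..<int q}. (if t = c mod int q then of_nat q * \<chi> t else 0)) - (\<Sum>t\<in>{0..<int q}. \<chi> t)"
    unfolding sum_subtractf[symmetric]
  proof (intro sum.cong refl)
    fix t assume "t \<in> {0..<int q}"
    then have "int q dvd c - t \<longleftrightarrow> t = c mod int q"
      by (auto simp: cong_def simp flip: cong_iff_dvd_diff)
    then show "\<chi> t * ramanujan (c - t) = (if t = c mod int q then of_nat q * \<chi> t else 0) - \<chi> t"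
      by (simp add: ramanujan_def algebra_simps)
  qed
  also have "\<dots> = of_nat q * \<chi> (c mod int q)" using q_gt_1 sum_chi by simp
  also have "\<chi> (c mod int q) = \<chi> c" by (intro chi_cong) simp
  finally show ?thesis .
qed

abbreviation "cyclotomic \<equiv> monom (1::eis) q - 1"
abbreviation "gauss_sum \<equiv> group_ring q \<chi>"
abbreviation "gauss_sum_cnj \<equiv> group_ring q (\<lambda>t. eis_cnj (\<chi> t))"

lemma gauss_sum_square:
  "ring_cong cyclotomic (gauss_sum * gauss_sum) (smult jacobi_sum gauss_sum_cnj)"
  using group_ring_mult[OF _ periodic periodic] q_gt_1
  by (simp add: chi_conv_chi group_ring_smult)

lemma gauss_sum_cnj_square:
  "ring_cong cyclotomic (gauss_sum_cnj * gauss_sum_cnj) (smult (eis_cnj jacobi_sum) gauss_sum)"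
proof -
  have "(\<Sum>t\<in>{0..<int q}. eis_cnj (\<chi> t) * eis_cnj (\<chi> (c - t))) = eis_cnj jacobi_sum * \<chi> c" for c
    using arg_cong[OF chi_conv_chi[of c], of eis_cnj] by simp
  then show ?thesis
    using group_ring_mult[OF _ periodic_cnj periodic_cnj] q_gt_1 by (simp add: group_ring_smult)
qed

lemma gauss_sum_mult_cnj:
  "ring_cong cyclotomic (gauss_sum_cnj * gauss_sum) (group_ring q ramanujan)"
  using group_ring_mult[OF _ periodic_cnj periodic] q_gt_1 by (simp add: eis_cnj_chi_conv_chi)

lemma gauss_sum_mult_ramanujan:
  "ring_cong cyclotomic (gauss_sum * group_ring q ramanujan) (smult (of_nat q) gauss_sum)"
  using group_ring_mult[OF _ periodic periodic_ramanujan] q_gt_1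
  by (simp add: chi_conv_ramanujan group_ring_smult)

text \<open>The cube of the Gauss sum is the Jacobi sum times the Ramanujan element. The spare
  factor in the exponent 3k + 1 is what allows this element to be replaced by q.\<close>

lemma gauss_sum_power:
  "ring_cong cyclotomic (gauss_sum ^ (3 * k + 1)) (smult ((of_nat q * jacobi_sum) ^ k) gauss_sum)"
proof (induction k)
  case (Suc k)
  define c where "c = (of_nat q * jacobi_sum) ^ k"
  have "ring_cong cyclotomic ((gauss_sum * gauss_sum) * gauss_sum * gauss_sum ^ (3 * k + 1))
          (smult jacobi_sum gauss_sum_cnj * gauss_sum * smult c gauss_sum)"
    unfolding c_def by (intro ring_cong_mult gauss_sum_square Suc ring_cong_refl)
  also have "smult jacobi_sum gauss_sum_cnj * gauss_sum * smult c gauss_sum =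
      smult (c * jacobi_sum) (gauss_sum * (gauss_sum_cnj * gauss_sum))"
    by (simp add: ac_simps)
  also have "ring_cong cyclotomic \<dots> (smult (c * jacobi_sum) (gauss_sum * group_ring q ramanujan))"
    by (intro ring_cong_smult ring_cong_mult gauss_sum_mult_cnj ring_cong_refl)
  also have "ring_cong cyclotomic \<dots> (smult (c * jacobi_sum) (smult (of_nat q) gauss_sum))"
    by (intro ring_cong_smult gauss_sum_mult_ramanujan)
  also have "\<dots> = smult ((of_nat q * jacobi_sum) ^ Suc k) gauss_sum"
    by (simp add: c_def ac_simps)
  also have "(gauss_sum * gauss_sum) * gauss_sum * gauss_sum ^ (3 * k + 1) = gauss_sum ^ (3 * Suc k + 1)"
  proof -
    have "3 * Suc k + 1 = Suc (Suc (Suc (3 * k + 1)))" by simp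
    then show ?thesis by (simp only: power_Suc ac_simps)
  qed
  finally show ?case .
qed simp

text \<open>The square of the Ramanujan element R is computed in two ways, giving N R and q R with N
  the norm of the Jacobi sum. The coefficient of R at X is -1, so comparing coefficients there gives
  N = q.\<close>

lemma jacobi_sum_norm: "eis_norm jacobi_sum = int q"
proof -
  let ?R = "group_ring q ramanujan"
  let ?N = "jacobi_sum * eis_cnj jacobi_sum"
  have "ring_cong cyclotomic (smult ?N ?R) (smult ?N (gauss_sum_cnj * gauss_sum))"
    by (intro ring_cong_smult ring_cong_sym[OF gauss_sum_mult_cnj])
  also have "\<dots> = smult jacobi_sum gauss_sum_cnj * smult (eis_cnj jacobi_sum) gauss_sum"
    by (simp add: ac_simps)
  also have "ring_cong cyclotomic \<dots> ((gauss_sum * gauss_sum) * (gauss_sum_cnj * gauss_sum_cnj))"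
    by (intro ring_cong_mult ring_cong_sym[OF gauss_sum_square] ring_cong_sym[OF gauss_sum_cnj_square])
  also have "\<dots> = (gauss_sum_cnj * gauss_sum) * (gauss_sum_cnj * gauss_sum)"
    by (simp add: ac_simps)
  also have "ring_cong cyclotomic \<dots> ((gauss_sum_cnj * gauss_sum) * ?R)"
    by (intro ring_cong_mult gauss_sum_mult_cnj ring_cong_refl)
  also have "\<dots> = gauss_sum_cnj * (gauss_sum * ?R)"
    by (simp add: ac_simps)
  also have "ring_cong cyclotomic \<dots> (gauss_sum_cnj * smult (of_nat q) gauss_sum)"
    by (intro ring_cong_mult gauss_sum_mult_ramanujan ring_cong_refl)
  also have "\<dots> = smult (of_nat q) (gauss_sum_cnj * gauss_sum)" by simp
  also have "ring_cong cyclotomic \<dots> (smult (of_nat q) ?R)"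
    by (intro ring_cong_smult gauss_sum_mult_cnj)
  finally have "cyclic_coeff q (smult ?N ?R - smult (of_nat q) ?R) = 0"
    using cyclic_coeff_dvd[OF q_gt_1] by (simp add: ring_cong_def)
  moreover have "ramanujan 1 = -1" using q_gt_1 by (simp add: ramanujan_def)
  ultimately have "?N = of_nat q"
    using q_gt_1 by (simp add: cyclic_coeff_diff cyclic_coeff_smult cyclic_coeff_group_ring)
  then have "ea (of_int (eis_norm jacobi_sum)) = ea (of_nat q)" by (simp only: mult_cnj)
  then show ?thesis by simp
qed

text \<open>Differences of cube roots of unity from 1 are multiples of \<omega> - 1, and (\<omega> -
  1)^2 = -3\<omega>; so each product of two character values is linear in them modulo 3. The linear
  relation is exact when one argument is divisible by q. It follows that the \<omega>-coordinate of
  the Jacobi sum is divisible by 3.\<close>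

lemma jacobi_sum_cong_3: "of_int 3 dvd jacobi_sum + of_nat q"
proof -
  have *: "of_int 3 dvd (z - 1) * (w - 1)" if "z ^ 3 = 1" "w ^ 3 = 1" for z w :: eis
    using that unfolding eis_cube_eq_1_iff of_int_dvd_eis_iff by (auto simp: power2_eq_square)
  have "ring_cong (of_int 3) jacobi_sum (\<Sum>t\<in>{0..<int q}. \<chi> t + \<chi> (1 - t) - 1)"
    unfolding jacobi_sum_def
  proof (intro ring_cong_sum)
    fix t
    consider "int q dvd t" | "int q dvd 1 - t" | "\<not> int q dvd t" "\<not> int q dvd 1 - t" by blast
    then show "ring_cong (of_int 3) (\<chi> t * \<chi> (1 - t)) (\<chi> t + \<chi> (1 - t) - 1)"
    proof cases
      case 1
      then have "\<chi> (1 - t) = \<chi> 1" by (intro chi_cong) (simp add: cong_iff_dvd_diff)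
      then show ?thesis using 1 by (simp add: zero)
    next
      case 2
      then have "\<chi> t = \<chi> 1" by (intro chi_cong) (simp add: cong_iff_dvd_diff dvd_diff_commute)
      then show ?thesis using 2 by (simp add: zero)
    next
      case 3
      then show ?thesis using *[OF cube cube, of t "1 - t"] by (simp add: ring_cong_def algebra_simps)
    qed
  qed
  also have "(\<Sum>t\<in>{0..<int q}. \<chi> t + \<chi> (1 - t) - 1) = - of_nat q"
    by (simp add: sum.distrib sum_subtractf sum_chi sum_chi_minus)
  finally show ?thesis by (simp add: ring_cong_def)
qed

text \<open>The power l^2 of the Gauss sum is evaluated twice: as a power of q J times the Gauss
  sum, and by applying Frobenius modulo l twice. The exponent is l^2 because it is 1 modulo 3 for
  every l other than 3, so it fixes the values of \<chi>. Since \<chi>(1) = 1, the coefficient at X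
  gives the claim.\<close>

lemma gauss_sum_frobenius:
  assumes l: "prime l" "l \<noteq> 3" "l \<noteq> q"
  shows "of_nat l dvd (of_nat q * jacobi_sum) ^ ((l ^ 2 - 1) div 3) - \<chi> (int l)"
proof -
  define k where "k = (l ^ 2 - 1) div 3"
  have k: "l ^ 2 = 3 * k + 1" unfolding k_def by (rule prime_square_mod_3) fact+
  have ql: "\<not> int q dvd int l" using l prime_q primes_dvd_imp_eq[of q l] by auto
  have ql2: "\<not> int q dvd int l ^ 2"
    using ql prime_q prime_dvd_power[of "int q" "int l" 2] by auto
  obtain d where d: "[int l ^ 2 * d = 1] (mod int q)" using inverse_exists[OF ql2] .
  \<comment> \<open>The inverse square of a cube root of unity is the root itself, so substituting
    X^(l^2) for X multiplies the Gauss sum by \<chi>(l).\<close>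
  have chi_d: "\<chi> d = \<chi> (int l)"
  proof -
    have "\<chi> (int l) ^ 2 * \<chi> d = 1"
      using chi_cong[OF d] by (simp add: mult power2_eq_square)
    moreover have "\<chi> (int l) ^ 3 * \<chi> d = \<chi> (int l) * (\<chi> (int l) ^ 2 * \<chi> d)"
      by (simp add: power3_eq_cube power2_eq_square ac_simps)
    ultimately show ?thesis using cube[OF ql] by simp
  qed
  define T where "T = (\<Sum>t\<in>{0..<int q}. monom (\<chi> t) (l ^ 2 * nat t))"
  have "ring_cong (of_nat l) (gauss_sum ^ l ^ 2) T"
  proof -
    have "ring_cong (of_nat l) (gauss_sum ^ l) (\<Sum>t\<in>{0..<int q}. monom (\<chi> t) (nat t) ^ l)"
      unfolding group_ring_def by (rule freshman_sum_ring_cong) fact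
    then have "ring_cong (of_nat l) ((gauss_sum ^ l) ^ l) ((\<Sum>t\<in>{0..<int q}. monom (\<chi> t) (nat t) ^ l) ^ l)"
      by (rule ring_cong_power)
    also have "ring_cong (of_nat l) \<dots> (\<Sum>t\<in>{0..<int q}. (monom (\<chi> t) (nat t) ^ l) ^ l)"
      by (rule freshman_sum_ring_cong) fact
    also have "\<dots> = T"
      unfolding T_def
    proof (intro sum.cong refl)
      fix t
      have "\<chi> t ^ (3 * k + 1) = \<chi> t"
        using zero[of t] cube[of t] by (cases "int q dvd t") (simp_all add: power_add power_mult)
      then have "\<chi> t ^ l ^ 2 = \<chi> t" using k by simp
      then have "monom (\<chi> t) (nat t) ^ l ^ 2 = monom (\<chi> t) (l ^ 2 * nat t)"
        by (simp add: monom_power mult.commute)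
      then show "(monom (\<chi> t) (nat t) ^ l) ^ l = monom (\<chi> t) (l ^ 2 * nat t)"
        by (simp add: power2_eq_square power_mult)
    qed
    finally show ?thesis by (simp add: power2_eq_square power_mult)
  qed
  then obtain G where G: "gauss_sum ^ l ^ 2 - T = of_nat l * G"
    unfolding ring_cong_def by (auto elim!: dvdE)
  have T: "ring_cong cyclotomic T (smult (\<chi> (int l)) gauss_sum)"
  proof -
    define h where "h = (\<lambda>c. monom (\<chi> (d * c)) (nat (c mod int q)))"
    have "periodic q h"
      unfolding h_def periodic_def using chi_cong by (metis cong_def cong_mult cong_refl)
    have "ring_cong cyclotomic T (\<Sum>t\<in>{0..<int q}. monom (\<chi> t) ((l ^ 2 * nat t) mod q))"
      unfolding T_def by (intro ring_cong_sum monom_mod_ring_cong)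
    also have "(\<Sum>t\<in>{0..<int q}. monom (\<chi> t) ((l ^ 2 * nat t) mod q)) = (\<Sum>t\<in>{0..<int q}. h (int l ^ 2 * t))"
    proof (intro sum.cong refl)
      fix t assume t: "t \<in> {0..<int q}"
      have "\<chi> (d * (int l ^ 2 * t)) = \<chi> t"
        using cong_mult[OF d cong_refl[of t]] by (intro chi_cong) (simp add: ac_simps)
      moreover have "nat (int l ^ 2 * t mod int q) = (l ^ 2 * nat t) mod q"
        using t by (simp add: nat_mod_distrib nat_mult_distrib nat_power_eq)
      ultimately show "monom (\<chi> t) ((l ^ 2 * nat t) mod q) = h (int l ^ 2 * t)" by (simp add: h_def)
    qed
    also have "\<dots> = (\<Sum>t\<in>{0..<int q}. h t)"
      using q_gt_1 by (intro sum_reindex_mult[OF _ \<open>periodic q h\<close> d]) simp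
    also have "\<dots> = group_ring q (\<lambda>c. \<chi> (int l) * \<chi> c)"
      unfolding group_ring_def h_def by (intro sum.cong refl) (auto simp: mult chi_d)
    finally show ?thesis by (simp add: group_ring_smult)
  qed
  \<comment> \<open>Two moduli are involved, l and X^q - 1. With the quotient G by l kept explicit,
    \<open>cyclic_coeff\<close> removes the second modulus and leaves a multiple of l.\<close>
  have "ring_cong cyclotomic (gauss_sum ^ l ^ 2 - T)
      (smult ((of_nat q * jacobi_sum) ^ k) gauss_sum - smult (\<chi> (int l)) gauss_sum)"
    unfolding k by (intro ring_cong_diff T gauss_sum_power)
  also have "gauss_sum ^ l ^ 2 - T = smult (of_nat l) G"
    by (simp add: G of_nat_poly)
  finally have "cyclic_coeff q (smult (of_nat l) G -
      (smult ((of_nat q * jacobi_sum) ^ k) gauss_sum - smult (\<chi> (int l)) gauss_sum)) = 0"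
    using cyclic_coeff_dvd[OF q_gt_1] by (simp add: ring_cong_def)
  then have "(of_nat q * jacobi_sum) ^ k - \<chi> (int l) = of_nat l * cyclic_coeff q G"
    using q_gt_1 by (simp add: cyclic_coeff_diff cyclic_coeff_smult cyclic_coeff_group_ring)
  then show ?thesis unfolding k_def by simp
qed

end

section \<open>Cubic reciprocity for a rational modulus\<close>

lemma fermat_int:
  assumes "prime q" "\<not> int q dvd a"
  shows "[a ^ (q - 1) = 1] (mod int q)"
proof -
  have q: "q > 0" using assms(1) prime_gt_0_nat by blast
  define b where "b = nat (a mod int q)"
  have b: "int b = a mod int q" using q by (simp add: b_def)
  have "\<not> q dvd b" using assms(2) b by (metis dvd_mod_iff dvd_refl int_dvd_int_iff)
  with assms(1) have "[b ^ (q - 1) = 1] (mod q)" by (rule fermat_theorem)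
  then have "[int b ^ (q - 1) = 1] (mod int q)" by (metis cong_int_iff of_nat_1 of_nat_power)
  moreover have "[int b = a] (mod int q)" by (simp add: b cong_def)
  ultimately show ?thesis by (metis cong_pow cong_sym cong_trans)
qed

text \<open>The value at a is \<omega> raised to the index of a for a primitive root. The index is
  defined modulo q - 1, hence modulo 3.\<close>

lemma cubic_character_exists:
  assumes q: "prime q" "q mod 3 = 1"
  shows "\<exists>\<chi>. cubic_character q \<chi>"
proof -
  have q1: "q > 1" using q(1) prime_gt_1_nat by blast
  obtain g where g: "residue_primroot q g" using prime_primitive_root_exists[of q] q q1 by blast
  then have cop: "coprime q g" and ord: "ord q g = q - 1"
    using q(1) by (auto simp: residue_primroot_def totient_prime)
  have ndvd: "\<not> q dvd g"
    using cop q1 coprime_absorb_left by fastforce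
  have index_exists: "\<exists>k. [int g ^ k = a] (mod int q)" if a: "\<not> int q dvd a" for a
  proof -
    have "nat (a mod int q) \<in> totatives q"
    proof -
      have "a mod int q \<ge> 0" "a mod int q \<noteq> 0" using a q1 by (auto simp: dvd_eq_mod_eq_0)
      then have "nat (a mod int q) > 0" by linarith
      then show ?thesis
        using q1 by (simp add: totatives_prime[OF q(1)] nat_less_iff)
    qed
    then have "nat (a mod int q) \<in> (\<lambda>i. g ^ i mod q) ` {..<totient q}"
      using residue_primroot_is_generator[OF q1 g] by (simp add: bij_betw_def)
    then obtain k where "g ^ k mod q = nat (a mod int q)" by auto
    then have "int (g ^ k mod q) = a mod int q" using q1 by simp
    then show ?thesis by (auto simp: cong_def zmod_int intro!: exI[of _ k])
  qed
  have index_cong: "omega ^ j = omega ^ k" if "[int g ^ j = int g ^ k] (mod int q)" for j k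
  proof -
    have "[g ^ j = g ^ k] (mod q)" using that by (metis cong_int_iff of_nat_power)
    then have "[j = k] (mod (q - 1))" using order_divides_expdiff[OF cop] ord by simp
    moreover have "3 dvd q - 1" using q(2) by presburger
    ultimately have "[j = k] (mod 3)" by (metis cong_dvd_modulus_nat)
    then show ?thesis by (rule omega_power_cong)
  qed
  define \<chi> where "\<chi> = (\<lambda>a. if int q dvd a then 0 else omega ^ (SOME k. [int g ^ k = a] (mod int q)))"
  have chi: "\<chi> a = omega ^ k" if "[int g ^ k = a] (mod int q)" for a k
  proof -
    have "\<not> int q dvd int g ^ k"
      using ndvd q(1) prime_dvd_power[of "int q" "int g" k] by auto
    then have a: "\<not> int q dvd a" using that cong_dvd_iff by blast
    have "[int g ^ (SOME k. [int g ^ k = a] (mod int q)) = a] (mod int q)"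
      using someI_ex[OF index_exists[OF a]] .
    then have "omega ^ (SOME k. [int g ^ k = a] (mod int q)) = omega ^ k"
      by (intro index_cong cong_trans[OF _ cong_sym[OF that]])
    then show ?thesis using a by (simp add: \<chi>_def)
  qed
  have "cubic_character q \<chi>"
  proof
    show "periodic q \<chi>"
      unfolding periodic_def
    proof (intro allI impI)
      fix a b assume ab: "[a = b] (mod int q)"
      show "\<chi> a = \<chi> b"
      proof (cases "int q dvd a")
        case True
        then show ?thesis using cong_dvd_iff[OF ab] by (simp add: \<chi>_def)
      next
        case False
        then obtain k where "[int g ^ k = a] (mod int q)" using index_exists by blast
        then show ?thesis using chi cong_trans ab by metis
      qed
    qed
    show "\<chi> (a * b) = \<chi> a * \<chi> b" for a b
    proof (cases "int q dvd a \<or> int q dvd b")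
      case True
      then show ?thesis by (auto simp: \<chi>_def)
    next
      case False
      then obtain j k where jk: "[int g ^ j = a] (mod int q)" "[int g ^ k = b] (mod int q)"
        using index_exists by blast
      then have "[int g ^ (j + k) = a * b] (mod int q)" by (simp add: power_add cong_mult)
      from chi[OF this] chi[OF jk(1)] chi[OF jk(2)] show ?thesis by (simp add: power_add)
    qed
    show "\<chi> a = 0" if "int q dvd a" for a using that by (simp add: \<chi>_def)
    show "\<chi> a ^ 3 = 1" if a: "\<not> int q dvd a" for a
    proof -
      obtain k where "[int g ^ k = a] (mod int q)" using index_exists[OF a] by blast
      then have "\<chi> a ^ 3 = (omega ^ k) ^ 3" using chi by simp
      also have "\<dots> = (omega ^ 3) ^ k" by (simp only: power_mult[symmetric] mult.commute)
      finally show ?thesis by simp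
    qed
    show "\<exists>g. \<not> int q dvd g \<and> \<chi> g \<noteq> 1"
    proof (intro exI conjI)
      show "\<not> int q dvd int g"
        using ndvd by simp
      show "\<chi> (int g) \<noteq> 1" using chi[of 1 "int g"] by simp
    qed
  qed fact
  then show ?thesis by blast
qed

text \<open>
  Only the residue modulo $l$ matters. For $l \equiv 2$ modulo 3 this is the usual cubic residue symbol
  of $z$, and for $l = \pi \bar\pi$ it is the symbol of $z / \bar z$ at $\pi$; taking $z^2 \bar z$
  and exponents $l^2 - 1$ avoids the case distinction.
\<close>

definition eis_symbol :: "nat \<Rightarrow> eis \<Rightarrow> eis" where
  "eis_symbol l z = (z ^ 2 * eis_cnj z) ^ ((l ^ 2 - 1) div 3)"

lemma eis_symbol_mult: "eis_symbol l (z * w) = eis_symbol l z * eis_symbol l w"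
  by (simp add: eis_symbol_def power_mult_distrib ac_simps)

lemma eis_symbol_cnj: "eis_symbol l (eis_cnj z) = eis_cnj (eis_symbol l z)"
  by (simp add: eis_symbol_def)

lemma eis_cnj_of_nat [simp]: "eis_cnj (of_nat k) = of_nat k"
  by (simp add: eis_eq_iff)

lemma ring_cong_cnj:
  assumes "ring_cong (of_nat l) z w"
  shows "ring_cong (of_nat l) (eis_cnj z) (eis_cnj w)"
proof -
  obtain c where "z - w = of_nat l * c" using assms by (auto simp: ring_cong_def elim: dvdE)
  then have "eis_cnj (z - w) = of_nat l * eis_cnj c" by simp
  then show ?thesis by (simp add: ring_cong_def)
qed

lemma eis_symbol_cong:
  "ring_cong (of_nat k) z w \<Longrightarrow> ring_cong (of_nat k) (eis_symbol l z) (eis_symbol l w)"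
  unfolding eis_symbol_def by (intro ring_cong_power ring_cong_mult ring_cong_cnj)

lemma of_nat_dvd_eis_iff: "of_nat l dvd z \<longleftrightarrow> int l dvd ea z \<and> int l dvd eb z"
  using of_int_dvd_eis_iff[of "int l" z] by simp

lemma ring_cong_of_int:
  "[a = b] (mod int l) \<Longrightarrow> ring_cong (of_nat l) (of_int a) (of_int b :: eis)"
  unfolding ring_cong_def of_nat_dvd_eis_iff by (simp add: cong_iff_dvd_diff)

lemma prime_square_minus_1_eq:
  assumes "prime (l::nat)" "l \<noteq> 3"
  shows "3 * ((l ^ 2 - 1) div 3) = (l - 1) * (l + 1)"
proof -
  have "l ^ 2 - 1 = (l - 1) * (l + 1)" by (cases l) (simp_all add: power2_eq_square)
  then show ?thesis using prime_square_mod_3[OF assms] by presburger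
qed

text \<open>For rational r the base is r^3, and three times the exponent is (l - 1)(l + 1), so
  Fermat's theorem applies.\<close>

lemma eis_symbol_of_int:
  assumes l: "prime l" "l \<noteq> 3" "\<not> int l dvd r"
  shows "ring_cong (of_nat l) (eis_symbol l (of_int r)) 1"
proof -
  have "of_int r ^ 2 * eis_cnj (of_int r) = of_int (r ^ 3)"
    by (simp add: power2_eq_square power3_eq_cube)
  then have "eis_symbol l (of_int r) = of_int (r ^ (3 * ((l ^ 2 - 1) div 3)))"
    by (simp only: eis_symbol_def of_int_power power_mult)
  also have "\<dots> = of_int ((r ^ (l - 1)) ^ (l + 1))"
    unfolding prime_square_minus_1_eq[OF l(1,2)] by (simp only: power_mult)
  also have "ring_cong (of_nat l) \<dots> (of_int (1 ^ (l + 1)))"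
    by (intro ring_cong_of_int cong_pow fermat_int l)
  finally show ?thesis by simp
qed

lemma eis_symbol_omega: "eis_symbol l omega = omega ^ ((l ^ 2 - 1) div 3)"
proof -
  have "omega ^ 2 * eis_cnj omega = omega" by (simp add: eis_cnj_omega eis_eq_iff power2_eq_square)
  then show ?thesis by (simp add: eis_symbol_def)
qed

definition sqrt_minus_3 :: eis where "sqrt_minus_3 = 1 + 2 * omega"

text \<open>The base is minus a cube. For odd l the exponent is even, which removes the sign and
  leaves a power of -3 with exponent a multiple of l - 1. For l = 2 the element is itself congruent
  to 1.\<close>

lemma eis_symbol_sqrt_minus_3:
  assumes l: "prime l" "l \<noteq> 3"
  shows "ring_cong (of_nat l) (eis_symbol l sqrt_minus_3) 1"
proof (cases "l = 2")
  case True
  have "ring_cong (of_nat l) sqrt_minus_3 1"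
    by (simp add: ring_cong_def of_nat_dvd_eis_iff sqrt_minus_3_def True)
  then have "ring_cong (of_nat l) (eis_symbol l sqrt_minus_3) (eis_symbol l 1)"
    by (rule eis_symbol_cong)
  then show ?thesis by (simp add: eis_symbol_def)
next
  case False
  then have "odd l" using l(1) primes_dvd_imp_eq two_is_prime_nat by blast
  then obtain k where k: "l = 2 * k + 1" by (elim oddE)
  have "3 * ((l ^ 2 - 1) div 3) = (l - 1) * (l + 1)" by (rule prime_square_minus_1_eq[OF l])
  then have e: "3 * ((l ^ 2 - 1) div 3) = 2 * ((l - 1) * (k + 1))" by (simp add: k algebra_simps)
  then have "even ((l ^ 2 - 1) div 3)" by presburger
  moreover have "sqrt_minus_3 ^ 2 * eis_cnj sqrt_minus_3 = - (sqrt_minus_3 ^ 3)"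
    by (simp add: sqrt_minus_3_def eis_eq_iff power2_eq_square power3_eq_cube)
  ultimately have "eis_symbol l sqrt_minus_3 = sqrt_minus_3 ^ (3 * ((l ^ 2 - 1) div 3))"
    by (simp add: eis_symbol_def power_mult)
  also have "\<dots> = (sqrt_minus_3 ^ 2) ^ ((l - 1) * (k + 1))" unfolding e by (simp only: power_mult)
  also have "sqrt_minus_3 ^ 2 = of_int (-3)"
    by (simp add: sqrt_minus_3_def eis_eq_iff power2_eq_square)
  also have "(of_int (-3) :: eis) ^ ((l - 1) * (k + 1)) = of_int (((-3) ^ (l - 1)) ^ (k + 1))"
    by (simp only: of_int_power power_mult)
  also have "ring_cong (of_nat l) \<dots> (of_int (1 ^ (k + 1)))"
  proof -
    have "\<not> int l dvd - 3"
      using l primes_dvd_imp_eq[of "int l" 3] by auto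
    then show ?thesis by (rule ring_cong_of_int[OF cong_pow[OF fermat_int[OF l(1)]]])
  qed
  finally show ?thesis by simp
qed

text \<open>Reciprocity for z against rational primes l: the symbol at l depends only on l modulo
  the norm. The link is a congruence because \<open>eis_symbol\<close> becomes a cube root of unity
  only modulo l. Values at integers sharing a factor with the norm are left open, so that the
  constant 1 can serve for rational z; the value at 3 is meaningful although no symbol at 3
  is.\<close>

definition reciprocity_character :: "eis \<Rightarrow> (int \<Rightarrow> eis) \<Rightarrow> bool" where
  "reciprocity_character z \<psi> \<longleftrightarrow>
     (\<forall>a b. \<psi> (a * b) = \<psi> a * \<psi> b) \<and>
     (\<forall>a b. [a = b] (mod eis_norm z) \<longrightarrow> \<psi> a = \<psi> b) \<and>
     (\<forall>a. coprime a (eis_norm z) \<longrightarrow> \<psi> a ^ 3 = 1) \<and>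
     (\<forall>l. prime l \<longrightarrow> l \<noteq> 3 \<longrightarrow> \<not> int l dvd eis_norm z \<longrightarrow>
        ring_cong (of_nat l) (eis_symbol l z) (\<psi> (int l)))"

lemma reciprocity_character_mult:
  assumes "reciprocity_character z \<psi>" "reciprocity_character w \<phi>"
  shows "reciprocity_character (z * w) (\<lambda>a. \<psi> a * \<phi> a)"
  unfolding reciprocity_character_def
proof (intro conjI allI impI)
  note z = assms(1)[unfolded reciprocity_character_def]
  note w = assms(2)[unfolded reciprocity_character_def]
  fix a b
  show "\<psi> (a * b) * \<phi> (a * b) = \<psi> a * \<phi> a * (\<psi> b * \<phi> b)" using z w by simp
  show "\<psi> a * \<phi> a = \<psi> b * \<phi> b" if "[a = b] (mod eis_norm (z * w))"
  proof -
    have "[a = b] (mod eis_norm z)" "[a = b] (mod eis_norm w)"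
      using that cong_dvd_modulus[of a b "eis_norm (z * w)"] by (simp_all add: eis_norm_mult)
    then show ?thesis using z w by metis
  qed
  show "(\<psi> a * \<phi> a) ^ 3 = 1" if "coprime a (eis_norm (z * w))"
    using that z w by (simp add: eis_norm_mult power_mult_distrib)
  fix l assume l: "prime l" "l \<noteq> 3" "\<not> int l dvd eis_norm (z * w)"
  then have "\<not> int l dvd eis_norm z" "\<not> int l dvd eis_norm w"
    by (auto simp: eis_norm_mult)
  with z w l show "ring_cong (of_nat l) (eis_symbol l (z * w)) (\<psi> (int l) * \<phi> (int l))"
    unfolding eis_symbol_mult by (intro ring_cong_mult) auto
qed

lemma reciprocity_character_of_int: "reciprocity_character (of_int r) (\<lambda>_. 1)"
proof -
  have "\<not> int l dvd r" if "\<not> int l dvd eis_norm (of_int r)" for l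
    using that by (auto simp: power2_eq_square)
  then show ?thesis unfolding reciprocity_character_def by (simp add: eis_symbol_of_int)
qed

lemma reciprocity_character_cnj:
  assumes "reciprocity_character z \<psi>"
  shows "reciprocity_character (eis_cnj z) (\<lambda>a. eis_cnj (\<psi> a))"
proof -
  have "ring_cong (of_nat l) (eis_symbol l (eis_cnj z)) (eis_cnj (\<psi> (int l)))"
    if "ring_cong (of_nat l) (eis_symbol l z) (\<psi> (int l))" for l
    using ring_cong_cnj[OF that] by (simp add: eis_symbol_cnj)
  moreover have "eis_cnj (\<psi> a) ^ 3 = 1" if "\<psi> a ^ 3 = 1" for a
    using arg_cong[OF that, of eis_cnj] by simp
  ultimately show ?thesis using assms unfolding reciprocity_character_def by (simp; metis)
qed

text \<open>As J has norm q, J^2 times its conjugate is q J, the base occurring in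
  \<open>gauss_sum_frobenius\<close>.\<close>

lemma (in cubic_character) reciprocity_character_jacobi_sum:
  "reciprocity_character jacobi_sum \<chi>"
  unfolding reciprocity_character_def jacobi_sum_norm
proof (intro conjI allI impI)
  fix a b
  show "\<chi> (a * b) = \<chi> a * \<chi> b" by (rule mult)
  show "\<chi> a = \<chi> b" if "[a = b] (mod int q)" using that by (rule chi_cong)
  show "\<chi> a ^ 3 = 1" if "coprime a (int q)"
    using that prime_q coprime_common_divisor[of a "int q" "int q"] by (intro cube notI) auto
  fix l assume l: "prime l" "l \<noteq> 3" "\<not> int l dvd int q"
  have "jacobi_sum ^ 2 * eis_cnj jacobi_sum = of_nat q * jacobi_sum"
    using mult_cnj[of jacobi_sum] jacobi_sum_norm by (simp add: power2_eq_square ac_simps)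
  then show "ring_cong (of_nat l) (eis_symbol l jacobi_sum) (\<chi> (int l))"
    using gauss_sum_frobenius[of l] l by (cases "l = q") (auto simp: ring_cong_def eis_symbol_def)
qed

section \<open>Factorisation into rational primes and Jacobi sums\<close>

lemma dvd_eis_norm_inert:
  assumes q: "prime q" "q mod 3 = 2" and dvd: "int q dvd a ^ 2 - a * b + b ^ 2"
  shows "int q dvd a \<and> int q dvd b"
proof -
  have pq: "prime (int q)" using q(1) by simp
  have *: "int q dvd b" if "int q dvd a" "int q dvd a ^ 2 - a * b + b ^ 2" for a b
  proof -
    have "int q dvd (a ^ 2 - a * b + b ^ 2) - a * (a - b)" using that by (intro dvd_diff) auto
    then have "int q dvd b ^ 2" by (simp add: power2_eq_square algebra_simps)
    then show ?thesis using pq prime_dvd_power by blast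
  qed
  have **: "int q dvd a" if "int q dvd b"
    using *[of b a] that dvd by (simp add: algebra_simps)
  show ?thesis
  proof (rule ccontr)
    assume "\<not> ?thesis"
    then have ndvd: "\<not> int q dvd a" "\<not> int q dvd b" using *[of a b] ** dvd by auto
    \<comment> \<open>This k inverts 3 modulo q - 1, so cubing is injective modulo q, and equality
      of the cubes of a and -b gives a = -b.\<close>
    define k where "k = (2 * q - 1) div 3"
    have k: "3 * k = 2 * (q - 1) + 1" using q(2) prime_gt_0_nat[OF q(1)] unfolding k_def by presburger
    have root: "[(c ^ 3) ^ k = c] (mod int q)" if "\<not> int q dvd c" for c
    proof -
      have "(c ^ 3) ^ k = (c ^ (q - 1)) ^ 2 * c"
        by (simp only: power_mult[symmetric] k power_add power_one_right mult.commute[of "q - 1"])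
      also have "[\<dots> = 1 ^ 2 * c] (mod int q)"
        by (intro cong_mult cong_pow fermat_int q that cong_refl)
      finally show ?thesis by simp
    qed
    have "int q dvd (a + b) * (a ^ 2 - a * b + b ^ 2)" using dvd by simp
    then have "[a ^ 3 = (- b) ^ 3] (mod int q)"
      by (simp add: cong_iff_dvd_diff power2_eq_square power3_eq_cube algebra_simps)
    then have "[(a ^ 3) ^ k = ((- b) ^ 3) ^ k] (mod int q)" by (rule cong_pow)
    then have "[a = - b] (mod int q)"
      using root[of a] root[of "- b"] ndvd by (metis cong_sym cong_trans dvd_minus_iff)
    then have ab: "int q dvd a + b" by (simp add: cong_iff_dvd_diff)
    have "int q dvd (a ^ 2 - a * b + b ^ 2) - (a + b) * (a - 2 * b)"
      using ab dvd by (intro dvd_diff) auto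
    also have "\<dots> = 3 * b ^ 2" by (simp add: power2_eq_square algebra_simps)
    finally have "int q dvd 3 \<or> int q dvd b"
      using pq by (metis prime_dvd_mult_iff prime_dvd_power)
    then have "q dvd 3" using ndvd by presburger
    then have "q = 3" using q(1) primes_dvd_imp_eq[of q 3] by simp
    then show False using q(2) by simp
  qed
qed

text \<open>A substitute for unique factorisation. The \<omega>-coordinates of z times the conjugate
  of w and of z w have a product divisible by the prime norm of w, so one of them is divisible by
  it. As the norms are divisible too, so is the other coordinate of that product, and cancelling a
  factor shows that w or its conjugate divides z.\<close>

lemma dvd_eis_norm_split:
  assumes q: "prime (eis_norm w)" and dvd: "eis_norm w dvd eis_norm z"
  shows "w dvd z \<or> eis_cnj w dvd z"
proof -
  let ?q = "eis_norm w"
  have *: "?q dvd ea u \<and> ?q dvd eb u" if "?q dvd eb u" "?q dvd eis_norm u" for u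
  proof -
    have "?q dvd eis_norm u - eb u * (eb u - ea u)" using that by (intro dvd_diff) auto
    then have "?q dvd ea u ^ 2" by (simp add: eis_norm_def power2_eq_square algebra_simps)
    then show ?thesis using q that prime_dvd_power by blast
  qed
  have norm: "?q dvd eis_norm (z * u)" for u using dvd by (simp add: eis_norm_mult)
  have cancel: "v dvd z" if "of_int ?q dvd z * u" "of_int ?q = v * u" for u v
  proof -
    have "u \<noteq> 0" using that(2) q by (auto simp: eis_eq_iff)
    then show ?thesis using that by simp
  qed
  have "eb (z * eis_cnj w) * eb (z * w) = eb z ^ 2 * ?q - eb w ^ 2 * eis_norm z"
    by (simp add: eis_norm_def power2_eq_square algebra_simps)
  then have "?q dvd eb (z * eis_cnj w) * eb (z * w)" using dvd by simp
  then consider "?q dvd eb (z * eis_cnj w)" | "?q dvd eb (z * w)" using q prime_dvd_multD by blast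
  then show ?thesis
  proof cases
    case 1
    then have "of_int ?q dvd z * eis_cnj w" using *[OF _ norm] unfolding of_int_dvd_eis_iff by blast
    then show ?thesis using cancel mult_cnj[of w, symmetric] by blast
  next
    case 2
    then have "of_int ?q dvd z * w" using *[OF _ norm] unfolding of_int_dvd_eis_iff by blast
    moreover have "of_int ?q = eis_cnj w * w" using mult_cnj[of w] by (simp add: mult.commute)
    ultimately show ?thesis using cancel by blast
  qed
qed

text \<open>Induction on the norm, splitting off q itself if q is 2 modulo 3, and a Jacobi sum or
  its conjugate if q is 1 modulo 3. These factors are rational integers modulo 3, so the cofactor
  inherits the hypotheses and the descent ends at rational integers.\<close>

lemma reciprocity_character_exists:
  assumes "\<not> 3 dvd ea z" "3 dvd eb z"
  shows "\<exists>\<psi>. reciprocity_character z \<psi>"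
  using assms
proof (induction "nat (eis_norm z)" arbitrary: z rule: less_induct)
  case less
  have step: "\<exists>\<psi>. reciprocity_character z \<psi>"
    if z: "z = w * u" and w: "reciprocity_character w \<phi>" "3 dvd eb w" "eis_norm w > 1" for w u \<phi>
  proof -
    have "3 dvd ea w * eb u + eb w * (ea u - eb u)"
      using less.prems(2) z by (simp add: algebra_simps)
    then have *: "3 dvd ea w * eb u" using w(2) dvd_add_left_iff by (metis dvd_mult2)
    have "\<not> 3 dvd ea w * ea u" using less.prems(1) w(2) z by (simp add: dvd_diff_left_iff)
    then have u: "\<not> 3 dvd ea u" "3 dvd eb u"
      using * prime_dvd_multD[of 3 "ea w" "eb u"] by auto
    have "eis_norm u \<noteq> 0" using u(1) by (auto simp: eis_norm_eq_0_iff)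
    then have "eis_norm u > 0" using eis_norm_nonneg[of u] by simp
    then have "eis_norm u < eis_norm z" unfolding z eis_norm_mult using w(3) by simp
    then obtain \<psi> where "reciprocity_character u \<psi>"
      using less.hyps[of u] u eis_norm_nonneg[of z] \<open>eis_norm u > 0\<close> by auto
    then show ?thesis unfolding z using reciprocity_character_mult[OF w(1)] by blast
  qed
  show ?case
  proof (cases "eb z = 0")
    case True
    then have "z = of_int (ea z)" by (simp add: eis_eq_iff)
    then show ?thesis using reciprocity_character_of_int by metis
  next
    case False
    then obtain b where b: "eb z = 3 * b" "b \<noteq> 0" using less.prems(2) by auto
    \<comment> \<open>A nonzero \<omega>-coordinate divisible by 3 rules out units, so the norm has
      a prime factor.\<close>
    have "b ^ 2 \<ge> 1" using b(2) by (simp add: int_one_le_iff_zero_less)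
    moreover have "4 * eis_norm z = (2 * ea z - 3 * b) ^ 2 + 27 * b ^ 2"
      unfolding four_eis_norm b(1) by (simp add: power_mult_distrib)
    ultimately have "4 * eis_norm z \<ge> 27"
      using zero_le_power2[of "2 * ea z - 3 * b"] by linarith
    then have "nat (eis_norm z) \<noteq> 1" by linarith
    then obtain q where q: "prime q" "q dvd nat (eis_norm z)" by (metis prime_factor_nat)
    then have dvd: "int q dvd eis_norm z" using eis_norm_nonneg[of z] by (metis int_dvd_int_iff nat_0_le)
    have q1: "q > 1" using q(1) prime_gt_1_nat by blast
    have "\<not> 3 dvd ea z ^ 2" using less.prems(1) prime_dvd_power[of "3::int"] by auto
    moreover have "eis_norm z = ea z ^ 2 + 3 * (3 * b ^ 2 - ea z * b)"
      unfolding eis_norm_def b(1) by (simp add: power2_eq_square algebra_simps)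
    ultimately have "\<not> 3 dvd eis_norm z" by (simp add: dvd_add_left_iff)
    then have "q \<noteq> 3" using dvd by auto
    then have "\<not> 3 dvd q" using q(1) primes_dvd_imp_eq[of 3 q] by auto
    then have "q mod 3 = 2 \<or> q mod 3 = 1" by presburger
    then consider "q mod 3 = 2" | "q mod 3 = 1" by blast
    then show ?thesis
    proof cases
      case 1
      then have "of_nat q dvd z"
        using dvd_eis_norm_inert[OF q(1)] dvd unfolding of_nat_dvd_eis_iff eis_norm_def by blast
      then obtain u where "z = of_nat q * u" by (elim dvdE)
      then have "z = of_int (int q) * u" by simp
      moreover have "eis_norm (of_int (int q)) > 1"
        unfolding eis_norm_of_int using q1 by (simp add: power2_eq_square less_1_mult)
      ultimately show ?thesis
        using step[OF _ reciprocity_character_of_int] by (metis dvd_0_right eb_of_int)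
    next
      case 2
      then obtain \<chi> where "cubic_character q \<chi>" using cubic_character_exists[OF q(1)] by blast
      then interpret cubic_character q \<chi> .
      have J: "3 dvd eb jacobi_sum" using jacobi_sum_cong_3 by (simp only: of_int_dvd_eis_iff) simp
      from dvd_eis_norm_split[of jacobi_sum z] consider "jacobi_sum dvd z" | "eis_cnj jacobi_sum dvd z"
        using q(1) dvd jacobi_sum_norm by auto
      then show ?thesis
      proof cases
        case 1
        then show ?thesis
          using step[OF _ reciprocity_character_jacobi_sum J] q1 jacobi_sum_norm by (auto elim!: dvdE)
      next
        case 2
        then show ?thesis
          using step[OF _ reciprocity_character_cnj[OF reciprocity_character_jacobi_sum]] J q1 jacobi_sum_norm
          by (auto elim!: dvdE)
      qed
    qed
  qed
qed

section \<open>The supplementary law at 3\<close>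

text \<open>The symbol of \<omega> at r, given by a formula that is multiplicative on all r prime to
  3.\<close>

definition kappa :: "nat \<Rightarrow> eis" where
  "kappa r = omega ^ ((r ^ 2 - 1) div 3)"

lemma nat_square_mod_3:
  assumes "\<not> 3 dvd (r::nat)"
  obtains i where "r ^ 2 = 3 * i + 1" "(r ^ 2 - 1) div 3 = i"
proof -
  have "r mod 3 = 1 \<or> r mod 3 = 2" using assms by presburger
  then have "(r mod 3) ^ 2 mod 3 = 1" by auto
  then have "r ^ 2 mod 3 = 1" by (simp add: power_mod)
  then have eq: "r ^ 2 = 3 * (r ^ 2 div 3) + 1" by presburger
  then have "r ^ 2 - 1 = 3 * (r ^ 2 div 3)" by linarith
  then have "(r ^ 2 - 1) div 3 = r ^ 2 div 3" by simp
  with eq show ?thesis by (rule that)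
qed

lemma kappa_mult:
  assumes "\<not> 3 dvd r" "\<not> 3 dvd s"
  shows "kappa (r * s) = kappa r * kappa s"
proof -
  obtain i where i: "r ^ 2 = 3 * i + 1" "(r ^ 2 - 1) div 3 = i" using nat_square_mod_3[OF assms(1)] .
  obtain j where j: "s ^ 2 = 3 * j + 1" "(s ^ 2 - 1) div 3 = j" using nat_square_mod_3[OF assms(2)] .
  have "(r * s) ^ 2 = 3 * (i + j + 3 * (i * j)) + 1"
    by (simp add: power_mult_distrib i j algebra_simps)
  then have "((r * s) ^ 2 - 1) div 3 = i + j + 3 * (i * j)" by simp
  moreover have "[i + j + 3 * (i * j) = i + j] (mod 3)" by (simp add: cong_def)
  ultimately have "kappa (r * s) = omega ^ (i + j)"
    unfolding kappa_def using omega_power_cong by metis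
  then show ?thesis using i j by (simp add: kappa_def power_add)
qed

lemma reciprocity_character_1:
  assumes "reciprocity_character z \<psi>"
  shows "\<psi> 1 = 1"
proof -
  have "\<psi> 1 ^ 3 = 1" using assms unfolding reciprocity_character_def by simp
  moreover have "\<psi> (1 * 1) = \<psi> 1 * \<psi> 1"
    using assms unfolding reciprocity_character_def by blast
  ultimately show ?thesis by auto
qed

lemma reciprocity_character_minus:
  assumes "reciprocity_character z \<psi>"
  shows "\<psi> (- r) = \<psi> r"
proof -
  have mult: "\<psi> (a * b) = \<psi> a * \<psi> b" for a b
    using assms unfolding reciprocity_character_def by blast
  have "\<psi> (-1) ^ 3 = 1" using assms unfolding reciprocity_character_def by simp
  moreover have "\<psi> (-1) * \<psi> (-1) = 1"
    using mult[of "-1" "-1"] reciprocity_character_1[OF assms] by simp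
  ultimately have "\<psi> (-1) = 1" by (simp add: power3_eq_cube)
  then show ?thesis using mult[of "-1" r] by simp
qed

text \<open>Both sides are cube roots of unity, so their congruence modulo l forces
  equality.\<close>

lemma reciprocity_character_prime_eq:
  assumes rc: "reciprocity_character z \<psi>" and l: "prime l" "l \<noteq> 3" "\<not> int l dvd eis_norm z"
    and c: "ring_cong (of_nat l) (eis_symbol l z) c" "c ^ 3 = 1"
  shows "\<psi> (int l) = c"
proof -
  have "coprime (int l) (eis_norm z)"
    using l prime_imp_coprime[of "int l" "eis_norm z"] by simp
  then have "\<psi> (int l) ^ 3 = 1" using rc unfolding reciprocity_character_def by blast
  moreover have "ring_cong (of_nat l) (\<psi> (int l)) c"
    using rc l c(1) unfolding reciprocity_character_def by (meson ring_cong_sym ring_cong_trans)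
  then have "of_int (int l) dvd \<psi> (int l) - c" by (simp add: ring_cong_def)
  ultimately show ?thesis
    using cube_roots_cong_imp_eq[of "\<psi> (int l)" c "int l"] l c(2) by auto
qed

text \<open>The exponents 0, 1 and 2 cover the cases where z is, modulo each prime factor of n, a
  rational multiple of 1 or of sqrt(-3), of \<omega>, or of \<omega>^2. The clause on 3 is carried
  along because multiplicativity of \<open>kappa\<close> depends on it.\<close>

lemma reciprocity_character_eval_nat:
  assumes rc: "reciprocity_character z \<psi>" and "n > 0"
    and "\<And>l. prime l \<Longrightarrow> l dvd n \<Longrightarrow>
      l \<noteq> 3 \<and> \<not> int l dvd eis_norm z \<and> ring_cong (of_nat l) (eis_symbol l z) (kappa l ^ j)"
  shows "\<psi> (int n) = kappa n ^ j \<and> \<not> 3 dvd n"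
  using assms(2,3)
proof (induction n rule: less_induct)
  case (less n)
  have cube: "(kappa r ^ j) ^ 3 = 1" for r
  proof -
    have "(kappa r ^ j) ^ 3 = (omega ^ 3) ^ ((r ^ 2 - 1) div 3 * j)"
      by (simp only: kappa_def power_mult[symmetric] ac_simps)
    then show ?thesis by simp
  qed
  show ?case
  proof (cases "n = 1")
    case True
    then show ?thesis using reciprocity_character_1[OF rc] by (simp add: kappa_def)
  next
    case False
    then obtain l where l: "prime l" "l dvd n" by (metis prime_factor_nat)
    then obtain k where k: "n = l * k" by (elim dvdE)
    have L: "l \<noteq> 3" "\<psi> (int l) = kappa l ^ j"
      using less.prems(2)[OF l] reciprocity_character_prime_eq[OF rc l(1)] cube by auto
    have "k < n" "k > 0" using less.prems(1) k prime_gt_1_nat[OF l(1)] by auto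
    then have K: "\<psi> (int k) = kappa k ^ j \<and> \<not> 3 dvd k"
      using less.prems(2) k by (intro less.IH) auto
    have "prime (3::nat)" by simp
    then have "\<not> 3 dvd l" using l(1) L(1) primes_dvd_imp_eq by blast
    moreover from this have "\<not> 3 dvd n" using K k \<open>prime 3\<close> by (simp add: prime_dvd_mult_iff)
    moreover have "\<psi> (int n) = \<psi> (int l) * \<psi> (int k)"
      using rc unfolding reciprocity_character_def k by simp
    ultimately show ?thesis using K L k by (simp add: kappa_mult power_mult_distrib)
  qed
qed

lemma reciprocity_character_eval:
  assumes rc: "reciprocity_character z \<psi>" and "r \<noteq> 0"
    and "\<And>l. prime l \<Longrightarrow> int l dvd r \<Longrightarrow>
      l \<noteq> 3 \<and> \<not> int l dvd eis_norm z \<and> ring_cong (of_nat l) (eis_symbol l z) (kappa l ^ j)"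
  shows "\<psi> r = kappa (nat \<bar>r\<bar>) ^ j"
proof -
  have "\<psi> (int (nat \<bar>r\<bar>)) = kappa (nat \<bar>r\<bar>) ^ j \<and> \<not> 3 dvd nat \<bar>r\<bar>"
    using assms by (intro reciprocity_character_eval_nat) auto
  then show ?thesis using reciprocity_character_minus[OF rc, of r] by (simp add: abs_if split: if_splits)
qed

lemma eis_symbol_of_int_mult:
  assumes "prime l" "l \<noteq> 3" "\<not> int l dvd r"
  shows "ring_cong (of_nat l) (eis_symbol l (of_int r * z)) (eis_symbol l z)"
  using ring_cong_mult[OF eis_symbol_of_int[OF assms] ring_cong_refl] by (simp add: eis_symbol_mult)

lemma eis_symbol_cong_mult:
  assumes "prime l" "l \<noteq> 3" "\<not> int l dvd r" "ring_cong (of_nat l) z (of_int r * w)"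
  shows "ring_cong (of_nat l) (eis_symbol l z) (eis_symbol l w)"
  using ring_cong_trans[OF eis_symbol_cong[OF assms(4)] eis_symbol_of_int_mult[OF assms(1-3)]] .

text \<open>
  The supplementary law at 3. Modulo the norm of $z = a + b \omega$ one has $a (a - b) \equiv - b^2$
  and $(2 a - b)^2 \equiv - 3 b^2$, so the value at 3 is governed by the primes dividing
  $a$, $a - b$ and $2 a - b$, at which $z$ is a rational number times $\omega$, $\omega^2$ and
  $\sqrt{-3}$, respectively.
\<close>

lemma reciprocity_character_3:
  fixes a b :: int
  defines "z \<equiv> of_int a + of_int b * omega"
  assumes rc: "reciprocity_character z \<psi>" and cop: "coprime a b" and a: "\<not> 3 dvd a" and b: "3 dvd b"
  shows "\<psi> 3 = omega ^ nat (a * (b div 3) mod 3)"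
proof -
  have mult: "\<psi> (r * s) = \<psi> r * \<psi> s" for r s
    using rc unfolding reciprocity_character_def by blast
  have cong: "\<psi> r = \<psi> s" if "[r = s] (mod eis_norm z)" for r s
    using rc that unfolding reciprocity_character_def by blast
  have norm: "eis_norm z = a ^ 2 - a * b + b ^ 2" by (simp add: z_def eis_norm_def)
  obtain b1 where b1: "b = 3 * b1" using b by (elim dvdE)
  have prime_ne_3: "l \<noteq> 3" if "int l dvd r" "\<not> 3 dvd r" for l :: nat and r :: int
    using that by auto
  have not_both: False if "prime l" "int l dvd a" "int l dvd b" for l
    using coprime_common_divisor[OF cop that(2,3)] that(1) by simp
  have sq: "int l dvd r" if "prime l" "int l dvd r ^ 2" for l r
    using that prime_dvd_power[of "int l" r 2] by simp
  have ab3: "\<not> 3 dvd a - b" using a b by (simp add: dvd_diff_left_iff)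
  have a2b3: "\<not> 3 dvd 2 * a - b" using a b by presburger
  have psi_a: "\<psi> a = kappa (nat \<bar>a\<bar>) ^ 1"
  proof (rule reciprocity_character_eval[OF rc])
    fix l assume l: "prime l" "int l dvd a"
    have l3: "l \<noteq> 3" using prime_ne_3 l a by blast
    have lb: "\<not> int l dvd b" using not_both l by blast
    have "\<not> int l dvd eis_norm z"
    proof
      assume "int l dvd eis_norm z"
      then have "int l dvd eis_norm z - a * (a - b)" using l by (intro dvd_diff) auto
      then have "int l dvd b ^ 2" by (simp add: norm power2_eq_square algebra_simps)
      then show False using sq l lb by blast
    qed
    moreover have "ring_cong (of_nat l) z (of_int b * omega)"
      using l(2) by (simp add: z_def ring_cong_def of_nat_dvd_eis_iff)
    then have "ring_cong (of_nat l) (eis_symbol l z) (kappa l ^ 1)"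
      using eis_symbol_cong_mult[OF l(1) l3 lb, of z omega] by (simp add: kappa_def eis_symbol_omega)
    ultimately show "l \<noteq> 3 \<and> \<not> int l dvd eis_norm z \<and> ring_cong (of_nat l) (eis_symbol l z) (kappa l ^ 1)"
      using l3 by blast
  qed (use a in auto)
  have psi_ab: "\<psi> (a - b) = kappa (nat \<bar>a - b\<bar>) ^ 2"
  proof (rule reciprocity_character_eval[OF rc])
    fix l assume l: "prime l" "int l dvd a - b"
    have l3: "l \<noteq> 3" using prime_ne_3 l ab3 by blast
    have la: "\<not> int l dvd a" using not_both l by (metis dvd_diff diff_diff_eq2 add_diff_cancel_left')
    have "\<not> int l dvd eis_norm z"
    proof
      assume "int l dvd eis_norm z"
      then have "int l dvd eis_norm z - (a - b) * (- b)" using l by (intro dvd_diff) auto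
      then have "int l dvd a ^ 2" by (simp add: norm power2_eq_square algebra_simps)
      then show False using sq l la by blast
    qed
    moreover have "ring_cong (of_nat l) z (of_int (- a) * (omega * omega))"
      using l(2) by (simp add: z_def ring_cong_def of_nat_dvd_eis_iff dvd_diff_commute)
    then have "ring_cong (of_nat l) (eis_symbol l z) (kappa l ^ 2)"
      using eis_symbol_cong_mult[OF l(1) l3, of "- a" z "omega * omega"] la
      by (simp add: kappa_def eis_symbol_mult eis_symbol_omega power2_eq_square)
    ultimately show "l \<noteq> 3 \<and> \<not> int l dvd eis_norm z \<and> ring_cong (of_nat l) (eis_symbol l z) (kappa l ^ 2)"
      using l3 by blast
  qed (use ab3 in auto)
  have psi_2ab: "\<psi> (2 * a - b) = kappa (nat \<bar>2 * a - b\<bar>) ^ 0"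
  proof (rule reciprocity_character_eval[OF rc])
    fix l assume l: "prime l" "int l dvd 2 * a - b"
    have l3: "l \<noteq> 3" using prime_ne_3 l a2b3 by blast
    have "\<not> int l dvd eis_norm z \<and> ring_cong (of_nat l) (eis_symbol l z) 1"
    \<comment> \<open>Comparing 2z with a multiple of sqrt(-3) says nothing at 2. There b is even,
      and z is congruent to the odd integer a.\<close>
    proof (cases "l = 2")
      case True
      then have b2: "2 dvd b" using l(2) by simp
      then have a2: "\<not> 2 dvd a" using not_both[of 2] by auto
      then have "\<not> 2 dvd eis_norm z" unfolding norm using b2 by simp
      moreover have "ring_cong (of_nat l) z (of_int a * 1)"
        unfolding ring_cong_def of_nat_dvd_eis_iff using b2 True by (simp add: z_def)
      then have "ring_cong (of_nat l) (eis_symbol l z) (eis_symbol l 1)"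
        using eis_symbol_cong_mult[OF l(1) l3, of a z 1] a2 True by simp
      ultimately show ?thesis using True by (simp add: eis_symbol_def)
    next
      case False
      then have l2: "\<not> int l dvd 2" using l(1) primes_dvd_imp_eq[of "int l" 2] by auto
      have lb: "\<not> int l dvd b"
      proof
        assume lb: "int l dvd b"
        then have "int l dvd 2 * a" using l(2) dvd_diff_right_iff by (metis dvd_add diff_add_cancel)
        then show False using lb l2 not_both l(1) prime_dvd_multD[of "int l" 2 a] by auto
      qed
      have "\<not> int l dvd eis_norm z"
      proof
        assume "int l dvd eis_norm z"
        then have "int l dvd 4 * eis_norm z - (2 * a - b) * (2 * a - b)" using l by (intro dvd_diff) auto
        then have "int l dvd 3 * b ^ 2" by (simp add: norm power2_eq_square algebra_simps)
        moreover have "\<not> int l dvd 3" using l3 l(1) primes_dvd_imp_eq[of "int l" 3] by auto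
        ultimately show False using sq[of l b] lb l(1) prime_dvd_multD[of "int l" 3 "b ^ 2"] by auto
      qed
      moreover have "ring_cong (of_nat l) (eis_symbol l z) 1"
      proof -
        have "ring_cong (of_nat l) (eis_symbol l z) (eis_symbol l (of_int 2 * z))"
          by (intro ring_cong_sym[OF eis_symbol_of_int_mult] l l3 l2)
        also have "ring_cong (of_nat l) (of_int 2 * z) (of_int b * sqrt_minus_3)"
          using l(2) by (simp add: z_def sqrt_minus_3_def ring_cong_def of_nat_dvd_eis_iff)
        then have "ring_cong (of_nat l) (eis_symbol l (of_int 2 * z)) (eis_symbol l (of_int b * sqrt_minus_3))"
          by (rule eis_symbol_cong)
        also have "ring_cong (of_nat l) \<dots> (eis_symbol l sqrt_minus_3)"
          by (intro eis_symbol_of_int_mult l l3 lb)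
        also have "ring_cong (of_nat l) \<dots> 1" by (intro eis_symbol_sqrt_minus_3 l l3)
        finally show ?thesis .
      qed
      ultimately show ?thesis by blast
    qed
    then show "l \<noteq> 3 \<and> \<not> int l dvd eis_norm z \<and> ring_cong (of_nat l) (eis_symbol l z) (kappa l ^ 0)"
      using l3 by simp
  qed (use a2b3 in auto)
  \<comment> \<open>As 3 divides b, the value at b is not accessible through \<open>kappa\<close>.
    Its square occurs in both relations and is eliminated between them.\<close>
  have "\<psi> (a * (a - b)) = \<psi> (- (b ^ 2))"
    by (intro cong) (simp add: cong_iff_dvd_diff norm power2_eq_square algebra_simps)
  moreover have "[(2 * a - b) ^ 2 = - (3 * b ^ 2)] (mod eis_norm z)"
  proof -
    have "(2 * a - b) ^ 2 - - (3 * b ^ 2) = eis_norm z * 4"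
      by (simp add: norm power2_eq_square algebra_simps)
    then show ?thesis unfolding cong_iff_dvd_diff by simp
  qed
  then have "\<psi> ((2 * a - b) ^ 2) = \<psi> (- (3 * b ^ 2))" by (rule cong)
  ultimately have "\<psi> 3 * (\<psi> a * \<psi> (a - b)) = 1"
    using psi_2ab by (simp add: reciprocity_character_minus[OF rc] mult power2_eq_square)
  then have *: "\<psi> 3 * (kappa (nat \<bar>a\<bar>) * kappa (nat \<bar>a - b\<bar>) ^ 2) = 1"
    using psi_a psi_ab by simp
  have "\<not> 3 dvd nat \<bar>a\<bar>" "\<not> 3 dvd nat \<bar>a - b\<bar>" using a ab3 by (simp_all add: nat_dvd_iff)
  then obtain i j where i: "nat \<bar>a\<bar> ^ 2 = 3 * i + 1" "(nat \<bar>a\<bar> ^ 2 - 1) div 3 = i"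
      and j: "nat \<bar>a - b\<bar> ^ 2 = 3 * j + 1" "(nat \<bar>a - b\<bar> ^ 2 - 1) div 3 = j"
    using nat_square_mod_3 by metis
  have "int (nat \<bar>a\<bar> ^ 2) = int (3 * i + 1)" "int (nat \<bar>a - b\<bar> ^ 2) = int (3 * j + 1)"
    using i(1) j(1) by simp_all
  then have ij: "a ^ 2 = 3 * int i + 1" "(a - b) ^ 2 = 3 * int j + 1" by simp_all
  \<comment> \<open>Modulo 3 this makes i + 2j, the exponent collected from a and a - b, equal to -a
    b1; the value at 3 is the inverse of that power of \<omega>.\<close>
  then have "int j = int i - 2 * (a * b1) + 3 * b1 ^ 2"
    by (simp add: b1 power2_eq_square algebra_simps)
  define k where "k = nat (a * b1 mod 3)"
  have k: "int k = a * b1 mod 3" by (simp add: k_def)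
  have "(X mod 3 + (I + 2 * J)) mod 3 = 0" if "J = I - 2 * X + 3 * Y" for X Y I J :: int
    using that by presburger
  from this[OF \<open>int j = _\<close>] have "[int (k + (i + 2 * j)) = 0] (mod 3)"
    by (simp add: cong_def k)
  then have "[k + (i + 2 * j) = 0] (mod 3)" by (metis cong_int_iff of_nat_0 of_nat_numeral)
  then have "omega ^ k * omega ^ (i + 2 * j) = 1"
    using omega_power_cong[of "k + (i + 2 * j)" 0] by (simp add: power_add)
  moreover have "\<psi> 3 * omega ^ (i + 2 * j) = 1"
    using * i(2) j(2) by (simp add: kappa_def power_add power_mult mult.commute[of 2])
  ultimately have "\<psi> 3 = omega ^ k"
    by (metis mult.left_commute mult.commute mult_1)
  then show ?thesis by (simp add: k_def b1)
qed

section \<open>The symbol of a quadratic form value\<close>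

lemma of_int_plus_sqrt_minus_3:
  "of_int u + of_int v * sqrt_minus_3 = of_int (u + v) + of_int (2 * v) * omega"
  by (simp add: eis_eq_iff sqrt_minus_3_def)

text \<open>In the basis 1, \<omega> the element u + v sqrt(-3) has coordinates u + v and 2v. Even
  for coprime u and v they share the factor c = 2 when both are odd.\<close>

lemma coprime_halving:
  fixes u v :: int
  assumes "coprime u v"
  obtains a b c where "c = 1 \<or> c = 2 \<and> odd u \<and> odd v" "c * a = u + v" "c * b = 2 * v" "coprime a b"
proof (cases "odd u \<and> odd v")
  case True
  then obtain a where a: "u + v = 2 * a" by (metis odd_even_add evenE)
  have "coprime a v"
  proof (rule coprimeI)
    fix k assume "k dvd a" "k dvd v"
    then have "k dvd 2 * a - v" by simp
    then have "k dvd u" using a by (metis add_diff_cancel_right')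
    then show "is_unit k" using assms \<open>k dvd v\<close> coprime_common_divisor by blast
  qed
  then show ?thesis using that[of 2 a v] True a by simp
next
  case False
  have "coprime (u + v) v"
  proof (rule coprimeI)
    fix k assume k: "k dvd u + v" "k dvd v"
    then have "k dvd u" by (simp add: dvd_add_left_iff)
    then show "is_unit k" using assms k(2) coprime_common_divisor by blast
  qed
  moreover have "odd (u + v)"
    using False assms by (metis coprime_common_divisor even_add odd_one)
  then have "coprime (u + v) 2" by simp
  ultimately show ?thesis using that[of 1 "u + v" "2 * v"] by simp
qed

lemma square_cong_1_mod_3:
  assumes "\<not> 3 dvd (k::int)"
  shows "[k ^ 2 = 1] (mod 3)"
proof -
  have "k mod 3 = 1 \<or> k mod 3 = 2" using assms by presburger
  then have "(k mod 3) ^ 2 mod 3 = 1" by auto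
  then show ?thesis by (simp add: cong_def power_mod)
qed

lemma cong_nat_mod_3:
  assumes "[int j = k] (mod 3)"
  shows "[j = nat (k mod 3)] (mod 3)"
  using assms cong_int_iff[of j "nat (k mod 3)" 3] by (simp add: cong_def)

text \<open>The last hypothesis ensures that odd primes other than 3 in A^2 - d B^2 end up in the
  sqrt(-3)-part of the reduced element, where the symbol is trivial. This leaves only powers of the
  value at 3.\<close>

lemma eis_symbol_quadratic_form:
  fixes d x y A B :: int
  assumes p: "prime p" "int p = x ^ 2 + 3 * d * y ^ 2" and d: "d > 1" "\<not> 9 dvd d"
    and xy: "\<not> 3 dvd y" "[x = y] (mod 3)"
    and AB: "coprime A B" "3 dvd A" "\<not> 9 dvd A"
    and D: "A ^ 2 - d * B ^ 2 \<noteq> 0"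
      "\<And>l. prime l \<Longrightarrow> l \<noteq> 2 \<Longrightarrow> l \<noteq> 3 \<Longrightarrow> int l dvd A ^ 2 - d * B ^ 2 \<Longrightarrow> int l dvd A"
  shows "ring_cong (of_nat p) (eis_symbol p (of_int (B * x) + of_int (A * y) * sqrt_minus_3))
    (omega ^ nat ((if 3 dvd d then A div 3 * B else - (A div 3 * B)) mod 3))"
proof -
  have pp: "prime (int p)" using p(1) by simp
  have p5: "p > 5" "int p > d" "int p > \<bar>y\<bar>"
    using prime_gt_5_d_y[OF d(1) p xy] by auto
  have prime3: "prime (3::int)" by simp
  have sq: "int l dvd r" if "prime l" "int l dvd r ^ 2" for l r
    using that prime_dvd_power[of "int l" r 2] by simp
  have not_both: False if "coprime r s" "prime l" "int l dvd r" "int l dvd s" for l r s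
    using coprime_common_divisor[OF that(1,3,4)] that(2) by simp
  have A0: "A \<noteq> 0" using AB(3) by auto
  have x3: "\<not> 3 dvd x" using xy cong_dvd_iff by blast
  have B3: "\<not> 3 dvd B" using coprime_common_divisor[OF AB(1,2)] by auto
  have "coprime x y"
  proof (rule coprimeI)
    fix k assume "k dvd x" "k dvd y"
    then have "k ^ 2 dvd int p" unfolding p(2) by (intro dvd_add dvd_mult) (auto intro: dvd_power_same)
    then show "is_unit k" using squarefree_prime[OF pp] unfolding squarefree_def by blast
  qed
  \<comment> \<open>Since A is prime to B and x to y, the common factors of B x and A y are g and h.
    Removing them leaves coprime u and v.\<close>
  define g where "g = gcd A x"
  define h where "h = gcd y B"
  have "g \<noteq> 0" "h \<noteq> 0" using A0 xy by (auto simp: g_def h_def)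
  then obtain A' x' y' B' where A': "A = A' * g" "x = x' * g" "coprime A' x'"
    and B': "y = y' * h" "B = B' * h" "coprime y' B'"
    unfolding g_def h_def using gcd_coprime_exists by metis
  define u where "u = B' * x'"
  define v where "v = A' * y'"
  have "coprime A' B'" "coprime x' y'"
    using AB(1) \<open>coprime x y\<close> unfolding A' B' by simp_all
  then have uv: "coprime u v" using A'(3) B'(3) by (simp add: u_def v_def coprime_commute)
  have g3: "\<not> 3 dvd g" using x3 A'(2) by auto
  have h3: "\<not> 3 dvd h" using xy B'(1) by auto
  have "3 dvd A'" using AB(2) A'(1) g3 prime_dvd_multD[OF prime3] by blast
  then obtain A3 where A3: "A' = 3 * A3" by (elim dvdE)
  have u3: "\<not> 3 dvd u" using B3 x3 prime_dvd_multD[OF prime3, of B' x'] unfolding u_def A' B' by auto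
  obtain a b c where c: "c = 1 \<or> c = 2 \<and> odd u \<and> odd v" and abc: "c * a = u + v" "c * b = 2 * v"
    and ab: "coprime a b" using coprime_halving[OF uv] .
  define z where "z = of_int a + of_int b * omega"
  define w where "w = of_int u + of_int v * sqrt_minus_3"
  have w: "w = of_int c * z"
    unfolding w_def of_int_plus_sqrt_minus_3 abc[symmetric] z_def by (simp add: algebra_simps)
  have c3: "\<not> 3 dvd c" using c by auto
  have v3: "3 dvd v" by (simp add: v_def A3)
  have a3: "\<not> 3 dvd a"
  proof
    assume "3 dvd a"
    then have "3 dvd u + v" unfolding abc(1)[symmetric] by simp
    then show False using u3 v3 dvd_add_left_iff by blast
  qed
  have "3 dvd c * b" unfolding abc(2) using v3 by simp
  then have b3: "3 dvd b" using c3 prime_dvd_multD[OF prime3] by blast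
  then obtain b1 where b1: "b = 3 * b1" by (elim dvdE)
  obtain \<psi> where rc: "reciprocity_character z \<psi>"
    using reciprocity_character_exists[of z] a3 b3 by (auto simp: z_def)
  have mult: "\<psi> (r * s) = \<psi> r * \<psi> s" for r s
    using rc unfolding reciprocity_character_def by blast
  have norm: "c ^ 2 * eis_norm z = u ^ 2 + 3 * v ^ 2"
  proof -
    have "c ^ 2 * eis_norm z = eis_norm w" unfolding w by (simp add: eis_norm_mult)
    then show ?thesis by (simp add: w_def eis_norm_def sqrt_minus_3_def power2_eq_square algebra_simps)
  qed
  \<comment> \<open>Substitute x^2 = p - 3 d y^2 and use B' y = B y'. This is how p enters a
    relation modulo the norm.\<close>
  have g2: "g ^ 2 * (u ^ 2 + 3 * v ^ 2) = B' ^ 2 * int p + 3 * y' ^ 2 * (A ^ 2 - d * B ^ 2)"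
    unfolding p(2) u_def v_def A' B' by (simp add: power2_eq_square algebra_simps)
  have norm_dvd: "eis_norm z dvd B' ^ 2 * int p + 3 * y' ^ 2 * (A ^ 2 - d * B ^ 2)"
    unfolding g2[symmetric] norm[symmetric] by simp
  have trivial: "\<not> int l dvd eis_norm z \<and> ring_cong (of_nat l) (eis_symbol l z) 1"
    if l: "prime l" "l \<noteq> 3" "int l dvd u * v" for l
  proof
    have pl: "prime (int l)" using l(1) by simp
    have l3: "\<not> int l dvd 3" using l primes_dvd_imp_eq[of "int l" 3] by auto
    have luv: "int l dvd u \<or> int l dvd v" using l(3) prime_dvd_multD[OF pl] by blast
    show "\<not> int l dvd eis_norm z"
    proof
      assume "int l dvd eis_norm z"
      then have N: "int l dvd u ^ 2 + 3 * v ^ 2" unfolding norm[symmetric] by simp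
      from luv show False
      proof
        assume lu: "int l dvd u"
        then have "int l dvd u ^ 2" by (simp add: power2_eq_square)
        then have "int l dvd 3 * v ^ 2" using N dvd_add_right_iff by blast
        then have "int l dvd v" using l3 sq[OF l(1)] prime_dvd_multD[OF pl] by blast
        then show False using not_both[OF uv l(1)] lu by blast
      next
        assume lv: "int l dvd v"
        then have "int l dvd 3 * v ^ 2" by (simp add: power2_eq_square)
        then have "int l dvd u" using N dvd_add_left_iff sq[OF l(1)] by blast
        then show False using not_both[OF uv l(1)] lv by blast
      qed
    qed
    have lc: "\<not> int l dvd c"
    proof
      assume lc: "int l dvd c"
      then have "c = 2" "odd u" "odd v" using c pl not_prime_unit by auto
      then have "int l = 2" using lc pl primes_dvd_imp_eq[of "int l" 2] by simp
      then show False using luv \<open>odd u\<close> \<open>odd v\<close> by simp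
    qed
    have "ring_cong (of_nat l) (eis_symbol l z) (eis_symbol l w)"
      unfolding w by (intro ring_cong_sym[OF eis_symbol_of_int_mult] l lc)
    also have "ring_cong (of_nat l) \<dots> 1"
    proof (cases "int l dvd u")
      case True
      then have "ring_cong (of_nat l) w (of_int v * sqrt_minus_3)"
        by (simp add: w_def ring_cong_def of_nat_dvd_eis_iff)
      moreover have "\<not> int l dvd v" using True not_both[OF uv l(1)] by blast
      ultimately have "ring_cong (of_nat l) (eis_symbol l w) (eis_symbol l sqrt_minus_3)"
        using eis_symbol_cong_mult[OF l(1,2)] by blast
      also have "ring_cong (of_nat l) \<dots> 1" by (rule eis_symbol_sqrt_minus_3[OF l(1,2)])
      finally show ?thesis .
    next
      case False
      then have "int l dvd v" using luv by blast
      then have "ring_cong (of_nat l) w (of_int u * 1)"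
        by (simp add: w_def ring_cong_def of_nat_dvd_eis_iff)
      then have "ring_cong (of_nat l) (eis_symbol l w) (eis_symbol l 1)"
        using eis_symbol_cong_mult[OF l(1,2) False] by blast
      then show ?thesis by (simp add: eis_symbol_def)
    qed
    finally show "ring_cong (of_nat l) (eis_symbol l z) 1" .
  qed
  have psi_1: "\<psi> r = 1"
    if "r \<noteq> 0" "\<not> 3 dvd r" "\<And>l. prime l \<Longrightarrow> l \<noteq> 3 \<Longrightarrow> int l dvd r \<Longrightarrow> int l dvd u * v" for r
  proof -
    have "\<psi> r = kappa (nat \<bar>r\<bar>) ^ 0"
    proof (rule reciprocity_character_eval[OF rc \<open>r \<noteq> 0\<close>])
      fix l assume l: "prime l" "int l dvd r"
      then have "l \<noteq> 3" using that(2) by auto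
      then show "l \<noteq> 3 \<and> \<not> int l dvd eis_norm z \<and> ring_cong (of_nat l) (eis_symbol l z) (kappa l ^ 0)"
        using trivial[of l] that(3)[of l] l by simp
    qed
    then show ?thesis by simp
  qed
  have psi_B: "\<psi> B' = 1"
    using B3 by (intro psi_1) (auto simp: B' u_def)
  have psi_y: "\<psi> y' = 1"
    using xy(1) by (intro psi_1) (auto simp: B' v_def)
  \<comment> \<open>The 3-adic order of A^2 - d B^2: 3 divides A but not B, and 9 does not divide
    d.\<close>
  define e where "e = (if 3 dvd d then 1 else 0 :: nat)"
  obtain A4 where A4: "A = 3 * A4" using AB(2) by (elim dvdE)
  obtain E where E: "A ^ 2 - d * B ^ 2 = 3 ^ e * E" "\<not> 3 dvd E"
  proof (cases "3 dvd d")
    case True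
    then obtain d1 where d1: "d = 3 * d1" by (elim dvdE)
    have "\<not> 3 dvd d1" using d(2) d1 by auto
    then have "\<not> 3 dvd d1 * B ^ 2"
      using B3 prime_dvd_multD[OF prime3] prime_dvd_power[OF prime3] by blast
    then have "\<not> 3 dvd 3 * A4 ^ 2 - d1 * B ^ 2" by (simp add: dvd_diff_right_iff)
    then show ?thesis
      using that[of "3 * A4 ^ 2 - d1 * B ^ 2"] True by (simp add: e_def A4 d1 power2_eq_square algebra_simps)
  next
    case False
    then have "\<not> 3 dvd d * B ^ 2"
      using B3 prime_dvd_multD[OF prime3] prime_dvd_power[OF prime3] by blast
    moreover have "3 dvd A ^ 2" by (simp add: A4 power2_eq_square)
    ultimately show ?thesis
      using that[of "A ^ 2 - d * B ^ 2"] False by (simp add: e_def dvd_diff_right_iff)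
  qed
  have psi_E: "\<psi> E = 1"
  proof (rule psi_1)
    fix l assume l: "prime l" "l \<noteq> 3" "int l dvd E"
    have pl: "prime (int l)" using l(1) by simp
    have lD: "int l dvd A ^ 2 - d * B ^ 2" using l(3) E(1) by simp
    show "int l dvd u * v"
    \<comment> \<open>An odd l divides A, hence d, so it cannot divide x without dividing p; it
      therefore survives the division by g and divides A'. For l = 2, were A', B', x', y' all odd,
      the parities of A, x would agree with g and those of B, y with h, and p odd would contradict
      A^2 - d B^2 even.\<close>
    proof (cases "l = 2")
      case False
      have lA: "int l dvd A" using D(2)[OF l(1) False l(2) lD] .
      then have "int l dvd A ^ 2" by (simp add: power2_eq_square)
      then have "int l dvd d * B ^ 2" using lD by (simp add: dvd_diff_right_iff)
      moreover have "\<not> int l dvd B" using lA not_both[OF AB(1) l(1)] by blast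
      ultimately have ld: "int l dvd d" using sq[OF l(1)] prime_dvd_multD[OF pl] by blast
      have "\<not> int l dvd x"
      proof
        assume "int l dvd x"
        then have "int l dvd int p" unfolding p(2) using ld by (intro dvd_add) (auto simp: power2_eq_square)
        then have "int l = int p" using primes_dvd_imp_eq[OF pl pp] by blast
        then show False using ld d(1) p5(2) zdvd_imp_le[of "int l" d] by simp
      qed
      then have "\<not> int l dvd g" using A'(2) by auto
      then have "int l dvd A'" using lA prime_dvd_multD[OF pl] unfolding A' by blast
      then show ?thesis by (simp add: v_def)
    next
      case True
      have "odd (int p)" using p(1) p5(1) prime_odd_nat by simp
      then have oddp: "odd (x ^ 2 + 3 * d * y ^ 2)" unfolding p(2) .
      have even: "even (A ^ 2 - d * B ^ 2)" using lD True by simp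
      have "even (B' * x' * (A' * y'))"
        using oddp even not_both[OF AB(1), of 2] unfolding A' B' by auto
      then show ?thesis using True by (simp add: u_def v_def)
    qed
  qed (use D(1) E in auto)
  define K where "K = nat (a * b1 mod 3)"
  have psi_3: "\<psi> 3 = omega ^ K"
    using reciprocity_character_3[of a b \<psi>] rc ab a3 b3 by (simp add: z_def K_def b1)
  have "[B' ^ 2 * int p = - (3 * y' ^ 2 * (A ^ 2 - d * B ^ 2))] (mod eis_norm z)"
    using norm_dvd by (simp add: cong_iff_dvd_diff)
  then have "\<psi> (B' ^ 2 * int p) = \<psi> (- (3 * y' ^ 2 * (A ^ 2 - d * B ^ 2)))"
    using rc unfolding reciprocity_character_def by blast
  then have psi_p: "\<psi> (int p) = omega ^ (K * (1 + e))"
    using psi_B psi_y psi_E psi_3 reciprocity_character_minus[OF rc] reciprocity_character_1[OF rc]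
    unfolding E(1)
    by (simp add: mult power2_eq_square e_def power_add power_mult split: if_splits)
  have p3: "\<not> int p dvd 3" using p5(1) zdvd_imp_le[of "int p" 3] by auto
  have pd: "\<not> int p dvd d" using p5(2) d(1) zdvd_imp_le[of "int p" d] by auto
  have py: "\<not> int p dvd y" using p5(3) xy(1) zdvd_not_zless[of "\<bar>y\<bar>" "int p"] by (cases "y = 0") auto
  have px: "\<not> int p dvd x"
  proof
    assume "int p dvd x"
    then have "int p dvd x ^ 2" by (simp add: power2_eq_square)
    then have "int p dvd 3 * d * y ^ 2" using p(2) by (metis dvd_add_right_iff dvd_refl)
    then show False using p3 pd py sq[OF p(1)] prime_dvd_multD[OF pp] by blast
  qed
  have pN: "\<not> int p dvd eis_norm z"
  proof
    assume "int p dvd eis_norm z"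
    then have "int p dvd B' ^ 2 * int p + 3 * y' ^ 2 * (A ^ 2 - d * B ^ 2)"
      using norm_dvd dvd_trans by blast
    then have "int p dvd 3 * y' ^ 2 * (A ^ 2 - d * B ^ 2)" by (simp add: dvd_add_right_iff)
    moreover have "\<not> int p dvd y'" using py B'(1) by auto
    ultimately have pD: "int p dvd A ^ 2 - d * B ^ 2"
      using p3 sq[OF p(1)] prime_dvd_multD[OF pp] by blast
    then have pA: "int p dvd A" using D(2)[OF p(1)] p5(1) by auto
    then have "int p dvd A ^ 2" by (simp add: power2_eq_square)
    then have "int p dvd d * B ^ 2" using pD by (simp add: dvd_diff_right_iff)
    moreover have "\<not> int p dvd B" using pA not_both[OF AB(1) p(1)] by blast
    ultimately show False using pd sq[OF p(1)] prime_dvd_multD[OF pp] by blast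
  qed
  have "ring_cong (of_nat p) (eis_symbol p z) (omega ^ (K * (1 + e)))"
    using rc p(1) p5(1) pN psi_p unfolding reciprocity_character_def by auto
  moreover have "ring_cong (of_nat p) (eis_symbol p (of_int (B * x) + of_int (A * y) * sqrt_minus_3))
      (eis_symbol p z)"
  proof (rule eis_symbol_cong_mult[OF p(1)])
    have "\<not> int p dvd c"
    proof
      assume "int p dvd c"
      then have "int p \<le> c" using c by (intro zdvd_imp_le) auto
      then show False using c p5(1) by auto
    qed
    moreover have "\<not> int p dvd g" "\<not> int p dvd h" using px py A'(2) B'(1) by auto
    ultimately show "\<not> int p dvd g * h * c" using prime_dvd_multD[OF pp] by blast
    have "of_int (B * x) + of_int (A * y) * sqrt_minus_3 = of_int (g * h) * w"
      unfolding w_def u_def v_def A' B' by (simp add: algebra_simps)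
    then show "ring_cong (of_nat p) (of_int (B * x) + of_int (A * y) * sqrt_minus_3) (of_int (g * h * c) * z)"
      by (simp add: w ac_simps)
  qed (use p5(1) in simp)
  moreover have "omega ^ (K * (1 + e)) =
      omega ^ nat ((if 3 dvd d then A div 3 * B else - (A div 3 * B)) mod 3)"
  proof -
    let ?T = "A div 3 * B"
    have "A = 3 * (A3 * g)" by (simp add: A' A3)
    then have T: "?T = A3 * g * B" by simp
    have "3 * (c * b1) = 3 * (2 * (A3 * y'))" using abc(2) by (simp add: b1 v_def A3 algebra_simps)
    then have abc1: "c * b1 = 2 * (A3 * y')" by (metis mult_left_cancel zero_neq_numeral)
    \<comment> \<open>Squares prime to 3 may be inserted freely modulo 3. The congruence of x and y
      turns x y into such a square and so fixes the sign. The remaining factor 2 acts as -1, and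
      doubling the exponent when 3 divides d reverses the sign again.\<close>
    have "[a * b1 = c ^ 2 * (a * b1)] (mod 3)"
      using cong_mult[OF square_cong_1_mod_3[OF c3] cong_refl[of "a * b1"]] by (simp add: cong_sym)
    also have "c ^ 2 * (a * b1) = (c * a) * (c * b1)" by (simp add: power2_eq_square)
    also have "\<dots> = 2 * (u * (A3 * y')) + 3 * (2 * A3 ^ 2 * y' ^ 2)"
      unfolding abc(1) abc1 by (simp add: v_def A3 power2_eq_square algebra_simps)
    also have "[\<dots> = 2 * (u * (A3 * y'))] (mod 3)" by (simp add: cong_iff_dvd_diff)
    also have "[2 * (u * (A3 * y')) = (g * h) ^ 2 * (2 * (u * (A3 * y')))] (mod 3)"
    proof -
      have "\<not> 3 dvd g * h" using g3 h3 prime_dvd_multD[OF prime3] by blast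
      then show ?thesis
        using cong_mult[OF square_cong_1_mod_3 cong_refl[of "2 * (u * (A3 * y'))"]] by (simp add: cong_sym)
    qed
    also have "(g * h) ^ 2 * (2 * (u * (A3 * y'))) = 2 * ?T * (x * y)"
      unfolding T by (simp add: u_def A' B' power2_eq_square)
    also have "[\<dots> = 2 * ?T * (y * y)] (mod 3)" by (intro cong_mult xy cong_refl)
    also have "[2 * ?T * (y * y) = 2 * ?T * 1] (mod 3)"
      using square_cong_1_mod_3[OF xy(1)] by (intro cong_mult cong_refl) (simp add: power2_eq_square)
    finally have "a * b1 mod 3 = 2 * ?T mod 3" by (simp add: cong_def)
    then have K: "int K = 2 * ?T mod 3" by (simp add: K_def)
    have aux: "2 * (- X mod 3) mod 3 = X mod 3" "2 * X mod 3 = - X mod 3" for X :: int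
      by presburger+
    have "[int (K * (1 + e)) = (if 3 dvd d then ?T else - ?T)] (mod 3)"
      using aux[of ?T] K by (simp add: e_def cong_def)
    then show ?thesis by (intro omega_power_cong cong_nat_mod_3)
  qed
  ultimately show ?thesis by (metis ring_cong_trans)
qed

section \<open>Powers of the unit modulo p\<close>

text \<open>If w is a root of w^2 + w + 1 modulo k, this is the ring homomorphism from the
  Eisenstein integers to the integers modulo k that sends \<omega> to w.\<close>

definition eis_eval :: "int \<Rightarrow> eis \<Rightarrow> int" where
  "eis_eval w z = ea z + eb z * w"

lemma eis_eval_mult:
  assumes "[w ^ 2 + w + 1 = 0] (mod k)"
  shows "[eis_eval w (z * z') = eis_eval w z * eis_eval w z'] (mod k)"
proof -
  have "eis_eval w z * eis_eval w z' - eis_eval w (z * z') = (w ^ 2 + w + 1) * (eb z * eb z')"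
    by (simp add: eis_eval_def power2_eq_square algebra_simps)
  then have "k dvd eis_eval w z * eis_eval w z' - eis_eval w (z * z')"
    using assms by (simp add: cong_0_iff)
  then show ?thesis by (simp add: cong_iff_dvd_diff dvd_diff_commute)
qed

lemma eis_eval_power:
  assumes "[w ^ 2 + w + 1 = 0] (mod k)"
  shows "[eis_eval w (z ^ j) = eis_eval w z ^ j] (mod k)"
proof (induction j)
  case (Suc j)
  have "[eis_eval w (z ^ Suc j) = eis_eval w z * eis_eval w (z ^ j)] (mod k)"
    unfolding power_Suc by (rule eis_eval_mult[OF assms])
  also have "[eis_eval w z * eis_eval w (z ^ j) = eis_eval w z * eis_eval w z ^ j] (mod k)"
    by (intro cong_mult cong_refl Suc)
  finally show ?case by simp
qed (simp add: eis_eval_def)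

lemma eis_eval_ring_cong:
  assumes "ring_cong (of_nat l) z z'"
  shows "[eis_eval w z = eis_eval w z'] (mod int l)"
proof -
  have "int l dvd ea z - ea z'" "int l dvd eb z - eb z'"
    using assms by (auto simp: ring_cong_def of_nat_dvd_eis_iff)
  then have "int l dvd (ea z - ea z') + (eb z - eb z') * w" by simp
  then show ?thesis by (simp add: cong_iff_dvd_diff eis_eval_def algebra_simps)
qed

text \<open>Lets cubes of integers prime to l be cancelled under the exponent of the symbol.\<close>

lemma cube_power_cong_1:
  assumes l: "prime l" "l \<noteq> 3" "\<not> int l dvd r"
  shows "[(r ^ 3) ^ ((l ^ 2 - 1) div 3) = 1] (mod int l)"
proof -
  have "(r ^ 3) ^ ((l ^ 2 - 1) div 3) = (r ^ (l - 1)) ^ (l + 1)"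
    by (simp only: power_mult[symmetric] prime_square_minus_1_eq[OF l(1,2)])
  also have "[\<dots> = 1 ^ (l + 1)] (mod int l)" by (intro cong_pow fermat_int l)
  finally show ?thesis by simp
qed

lemma cong_cancel_units:
  fixes a b c d k :: int
  assumes "[a * c = b * d] (mod k)" "[a = 1] (mod k)" "[b = 1] (mod k)"
  shows "[c = d] (mod k)"
proof -
  have "[1 * c = a * c] (mod k)" by (intro cong_mult cong_sym[OF assms(2)] cong_refl)
  also note assms(1)
  also have "[b * d = 1 * d] (mod k)" by (intro cong_mult assms cong_refl)
  finally show ?thesis by simp
qed

lemma Legendre_3: "Legendre a 3 = (if a mod 3 = 0 then 0 else if a mod 3 = 1 then 1 else -1)"
proof -
  have "a mod 3 = 1" if "\<not> 3 dvd a" "QuadRes 3 a"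
  proof -
    obtain b where b: "[b ^ 2 = a] (mod 3)" using \<open>QuadRes 3 a\<close> by (auto simp: QuadRes_def)
    then have "\<not> 3 dvd b ^ 2" using \<open>\<not> 3 dvd a\<close> cong_dvd_iff by blast
    then have "\<not> 3 dvd b" by (auto simp: power2_eq_square)
    then have "[a = 1] (mod 3)" using square_cong_1_mod_3 b cong_sym cong_trans by blast
    then show ?thesis by (simp add: cong_def)
  qed
  moreover have "QuadRes 3 a" if "a mod 3 = 1"
    unfolding QuadRes_def using that by (intro exI[of _ 1]) (simp add: cong_def)
  ultimately show ?thesis by (auto simp: Legendre_def cong_def dvd_eq_mod_eq_0)
qed

text \<open>Here \<open>half\<close> is 1/2 and \<open>t\<close> is (x / (d y)) sqrt d modulo p, so
  \<open>t\<close> is a square root of -3 and (-1 + \<open>t\<close>)/2 the corresponding primitive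
  cube root of unity.\<close>

locale unit_power =
  fixes d m n x y s half t :: int and p :: nat
  assumes d: "d > 1" "squarefree d"
    and n: "n \<noteq> 0" and mn: "m ^ 2 - d * n ^ 2 = 4"
    and p: "prime p" "\<not> int p dvd n" "int p = x ^ 2 + 3 * d * y ^ 2"
    and xy: "\<not> 3 dvd y" "[x = y] (mod 3)"
    and s: "[s ^ 2 = d] (mod int p)"
    and half: "[2 * half = 1] (mod int p)"
    and t: "[d * y * t = x * s] (mod int p)"
begin

definition w :: int where "w = half * (-1 + t)"
definition eps :: int where "eps = (m + n * s) * half"

lemma prime_int: "prime (int p)"
  using p(1) by simp

lemma p_gt: "p > 5" "int p > d" "int p > \<bar>y\<bar>"
  using prime_gt_5_d_y[OF d(1) p(1,3) xy] by auto

lemma p_neq_3: "p \<noteq> 3"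
  using p_gt by simp

lemma not_9_dvd: "\<not> 9 dvd d"
  using squarefreeD[OF d(2), of 3] by auto

lemma not_p_dvd_small: "0 < k \<Longrightarrow> k < int p \<Longrightarrow> \<not> int p dvd k"
  using zdvd_not_zless by blast

lemma p_dvd_mult_iff: "int p dvd a * b \<longleftrightarrow> int p dvd a \<or> int p dvd b"
  using prime_int prime_dvd_mult_iff by blast

lemma p_dvd_power2_iff: "int p dvd a ^ 2 \<longleftrightarrow> int p dvd a"
  by (simp add: power2_eq_square p_dvd_mult_iff)

lemma not_p_dvd: "\<not> int p dvd 2" "\<not> int p dvd 3" "\<not> int p dvd d" "\<not> int p dvd y" "\<not> int p dvd x"
  "\<not> int p dvd s"
proof -
  show 2: "\<not> int p dvd 2" "\<not> int p dvd 3"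
    using p_gt not_p_dvd_small[of 2] not_p_dvd_small[of 3] by auto
  show d: "\<not> int p dvd d" using p_gt d by (intro not_p_dvd_small) auto
  have "\<not> int p dvd \<bar>y\<bar>" using p_gt xy(1) by (intro not_p_dvd_small) auto
  then show y: "\<not> int p dvd y" by simp
  show "\<not> int p dvd x"
  proof
    assume "int p dvd x"
    then have "int p dvd x ^ 2" by (simp add: power2_eq_square)
    then have "int p dvd 3 * d * y ^ 2" using p(3) by (metis dvd_add_right_iff dvd_refl)
    then show False using 2 d y by (simp add: p_dvd_mult_iff p_dvd_power2_iff)
  qed
  show "\<not> int p dvd s"
    using cong_dvd_iff[OF s] d by (simp add: p_dvd_power2_iff)
qed

lemma cancel: "\<not> int p dvd k \<Longrightarrow> [k * a = k * b] (mod int p) \<Longrightarrow> [a = b] (mod int p)"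
  using prime_int prime_imp_coprime[of "int p" k] cong_mult_lcancel[of k "int p" a b]
  by (simp add: coprime_commute)

lemma syt: "[s * y * t = x] (mod int p)"
proof (rule cancel[OF not_p_dvd(6)])
  have "[s ^ 2 * (y * t) = d * (y * t)] (mod int p)" by (intro cong_mult s cong_refl)
  also have "d * (y * t) = d * y * t" by simp
  also note t
  finally show "[s * (s * y * t) = s * x] (mod int p)" by (simp add: power2_eq_square ac_simps)
qed

lemma t_square: "[t ^ 2 = -3] (mod int p)"
proof (rule cancel[of "d * y ^ 2"])
  show "\<not> int p dvd d * y ^ 2" using not_p_dvd by (simp add: p_dvd_mult_iff p_dvd_power2_iff)
  have "[d * (y ^ 2 * t ^ 2) = s ^ 2 * (y ^ 2 * t ^ 2)] (mod int p)"
    by (intro cong_mult cong_sym[OF s] cong_refl)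
  also have "s ^ 2 * (y ^ 2 * t ^ 2) = (s * y * t) ^ 2" by (simp add: power_mult_distrib)
  also have "[\<dots> = x ^ 2] (mod int p)" by (intro cong_pow syt)
  also have "[x ^ 2 = d * y ^ 2 * (-3)] (mod int p)"
    by (simp add: cong_iff_dvd_diff p(3) algebra_simps)
  finally show "[d * y ^ 2 * t ^ 2 = d * y ^ 2 * - 3] (mod int p)" by (simp add: ac_simps)
qed

lemma two_w: "[1 + 2 * w = t] (mod int p)"
proof -
  have "[1 + 2 * half * (-1 + t) = 1 + 1 * (-1 + t)] (mod int p)"
    by (intro cong_add cong_mult half cong_refl)
  then show ?thesis by (simp add: w_def ac_simps)
qed

lemma w_cube_root: "[w ^ 2 + w + 1 = 0] (mod int p)"
proof (rule cancel[of 4])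
  show "\<not> int p dvd 4" using not_p_dvd(1) p_dvd_power2_iff[of 2] by simp
  have "4 * (w ^ 2 + w + 1) = (1 + 2 * w) ^ 2 + 3" by (simp add: power2_eq_square algebra_simps)
  also have "[\<dots> = t ^ 2 + 3] (mod int p)" by (intro cong_add cong_pow two_w cong_refl)
  also have "[t ^ 2 + 3 = -3 + 3] (mod int p)" by (intro cong_add t_square cong_refl)
  finally show "[4 * (w ^ 2 + w + 1) = 4 * 0] (mod int p)" by simp
qed

lemma w_square: "[half * (- 1 - t) = w ^ 2] (mod int p)"
proof -
  have "[half * (- 1 - t) = half * (- 1 - t) + (w ^ 2 + w + 1)] (mod int p)"
    using cong_add[OF cong_refl[of "half * (- 1 - t)"] cong_sym[OF w_cube_root]] by simp
  also have "half * (- 1 - t) + (w ^ 2 + w + 1) = w ^ 2 + (1 - 2 * half)"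
    by (simp add: w_def algebra_simps)
  also have "[\<dots> = w ^ 2 + (1 - 1)] (mod int p)" by (intro cong_add cong_diff half cong_refl)
  finally show ?thesis by simp
qed

lemma w_power_cong:
  assumes "[j = k] (mod 3)"
  shows "[w ^ j = w ^ k] (mod int p)"
proof -
  have "[eis_eval w (omega ^ i) = w ^ i] (mod int p)" for i
    using eis_eval_power[OF w_cube_root, of omega i] by (simp add: eis_eval_def)
  then show ?thesis using omega_power_cong[OF assms] by (metis cong_sym cong_trans)
qed

text \<open>Evaluation at \<omega> = w sends \<gamma> to B x + A y t, and s times this is x (A + B
  s). For the conjugate it is -x (A - B s). The leftover factors s^3 and (-x)^3 are cubes and
  disappear under the exponent.\<close>

lemma norm_form_power:
  assumes AB: "coprime A B" "3 dvd A" "\<not> 9 dvd A" "A ^ 2 - d * B ^ 2 \<noteq> 0"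
    "\<And>l. prime l \<Longrightarrow> l \<noteq> 2 \<Longrightarrow> l \<noteq> 3 \<Longrightarrow> int l dvd A ^ 2 - d * B ^ 2 \<Longrightarrow> int l dvd A"
  shows "[((A + B * s) ^ 2 * (A - B * s)) ^ ((p ^ 2 - 1) div 3) =
    w ^ nat ((if 3 dvd d then A div 3 * B else - (A div 3 * B)) mod 3)] (mod int p)"
proof -
  define e where "e = (p ^ 2 - 1) div 3"
  define K where "K = nat ((if 3 dvd d then A div 3 * B else - (A div 3 * B)) mod 3)"
  define z where "z = of_int (B * x) + of_int (A * y) * sqrt_minus_3"
  define Q where "Q = (B * x + A * y * t) ^ 2 * (B * x - A * y * t)"
  have ev: "[eis_eval w z = B * x + A * y * t] (mod int p)"
  proof -
    have "eis_eval w z = B * x + A * y * (1 + 2 * w)"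
      by (simp add: z_def eis_eval_def sqrt_minus_3_def algebra_simps)
    then show ?thesis by (auto intro!: cong_add cong_mult two_w)
  qed
  have ev_cnj: "[eis_eval w (eis_cnj z) = B * x - A * y * t] (mod int p)"
  proof -
    have "eis_eval w (eis_cnj z) = B * x - A * y * (1 + 2 * w)"
      by (simp add: z_def eis_eval_def sqrt_minus_3_def algebra_simps)
    then show ?thesis by (auto intro!: cong_diff cong_mult two_w)
  qed
  have "[Q = eis_eval w z ^ 2 * eis_eval w (eis_cnj z)] (mod int p)"
    unfolding Q_def by (intro cong_mult cong_pow cong_sym[OF ev] cong_sym[OF ev_cnj])
  also have "[eis_eval w z ^ 2 * eis_eval w (eis_cnj z) = eis_eval w (z ^ 2) * eis_eval w (eis_cnj z)] (mod int p)"
    by (intro cong_mult cong_refl cong_sym[OF eis_eval_power[OF w_cube_root]])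
  also have "[eis_eval w (z ^ 2) * eis_eval w (eis_cnj z) = eis_eval w (z ^ 2 * eis_cnj z)] (mod int p)"
    by (intro cong_sym[OF eis_eval_mult[OF w_cube_root]])
  finally have "[Q ^ e = eis_eval w (z ^ 2 * eis_cnj z) ^ e] (mod int p)" by (rule cong_pow)
  also have "[eis_eval w (z ^ 2 * eis_cnj z) ^ e = eis_eval w (eis_symbol p z)] (mod int p)"
    unfolding eis_symbol_def e_def by (intro cong_sym[OF eis_eval_power[OF w_cube_root]])
  also have "[eis_eval w (eis_symbol p z) = eis_eval w (omega ^ K)] (mod int p)"
    unfolding z_def K_def
    by (intro eis_eval_ring_cong eis_symbol_quadratic_form p d not_9_dvd xy AB)
  also have "[eis_eval w (omega ^ K) = eis_eval w omega ^ K] (mod int p)" by (rule eis_eval_power[OF w_cube_root])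
  also have "eis_eval w omega = w" by (simp add: eis_eval_def)
  finally have Q: "[Q ^ e = w ^ K] (mod int p)" .
  have 1: "[s * (B * x + A * y * t) = x * (A + B * s)] (mod int p)"
  proof -
    have "[s * B * x + A * (s * y * t) = s * B * x + A * x] (mod int p)"
      by (intro cong_add cong_mult syt cong_refl)
    then show ?thesis by (simp add: algebra_simps)
  qed
  have 2: "[s * (B * x - A * y * t) = - x * (A - B * s)] (mod int p)"
  proof -
    have "[s * B * x - A * (s * y * t) = s * B * x - A * x] (mod int p)"
      by (intro cong_diff cong_mult syt cong_refl)
    then show ?thesis by (simp add: algebra_simps)
  qed
  have "s ^ 3 * Q = (s * (B * x + A * y * t)) ^ 2 * (s * (B * x - A * y * t))"
    by (simp add: Q_def power2_eq_square power3_eq_cube)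
  also have "[\<dots> = (x * (A + B * s)) ^ 2 * (- x * (A - B * s))] (mod int p)"
    by (intro cong_mult cong_pow 1 2)
  also have "(x * (A + B * s)) ^ 2 * (- x * (A - B * s)) = (- x) ^ 3 * ((A + B * s) ^ 2 * (A - B * s))"
    by (simp add: power2_eq_square power3_eq_cube)
  finally have "[(s ^ 3) ^ e * Q ^ e = ((- x) ^ 3) ^ e * ((A + B * s) ^ 2 * (A - B * s)) ^ e] (mod int p)"
    unfolding power_mult_distrib[symmetric] by (rule cong_pow)
  moreover have "[(s ^ 3) ^ e = 1] (mod int p)" "[((- x) ^ 3) ^ e = 1] (mod int p)"
    unfolding e_def using not_p_dvd by (intro cube_power_cong_1 p p_neq_3; simp)+
  ultimately have "[Q ^ e = ((A + B * s) ^ 2 * (A - B * s)) ^ e] (mod int p)"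
    by (rule cong_cancel_units)
  then have "[((A + B * s) ^ 2 * (A - B * s)) ^ e = Q ^ e] (mod int p)" by (rule cong_sym)
  then show ?thesis using Q unfolding e_def K_def by (rule cong_trans)
qed

definition eps' :: int where "eps' = (m - n * s) * half"

lemma two_eps: "[2 * eps = m + n * s] (mod int p)" "[2 * eps' = m - n * s] (mod int p)"
proof -
  have *: "[2 * (k * half) = k] (mod int p)" for k
    using cong_mult[OF half cong_refl[of k]] by (simp add: ac_simps)
  show "[2 * eps = m + n * s] (mod int p)" "[2 * eps' = m - n * s] (mod int p)"
    unfolding eps_def eps'_def by (rule *)+
qed

lemma eps_mult: "[eps * eps' = 1] (mod int p)"
proof (rule cancel[of 4])
  show "\<not> int p dvd 4" using not_p_dvd(1) p_dvd_power2_iff[of 2] by simp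
  have "4 * (eps * eps') = (2 * eps) * (2 * eps')" by simp
  also have "[\<dots> = (m + n * s) * (m - n * s)] (mod int p)" by (intro cong_mult two_eps)
  also have "(m + n * s) * (m - n * s) = m ^ 2 - n ^ 2 * s ^ 2"
    by (simp add: power2_eq_square algebra_simps)
  also have "[\<dots> = m ^ 2 - n ^ 2 * d] (mod int p)" by (intro cong_diff cong_mult s cong_refl)
  also have "m ^ 2 - n ^ 2 * d = 4 * 1" using mn by (simp add: mult.commute)
  finally show "[4 * (eps * eps') = 4 * 1] (mod int p)" .
qed

lemma not_p_dvd_eps: "\<not> int p dvd eps"
  using cong_dvd_iff[OF eps_mult] p_gt by auto

definition L :: int where "L = eps ^ ((p - 1) div 3)"

lemma L_cube: "[L ^ 3 = 1] (mod int p)"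
proof -
  have "3 dvd p - 1" using exponent_exact[OF d(1) p(1,3) xy] .
  then have "L ^ 3 = eps ^ (p - 1)" by (simp add: L_def flip: power_mult)
  then show ?thesis using fermat_int[OF p(1) not_p_dvd_eps] by simp
qed

text \<open>The exponent is (p - 1)/3 times p + 1 = (p - 1) + 2. The symbol thus sees L^2, which is
  the inverse of L.\<close>

lemma eps_power: "[eps ^ ((p ^ 2 - 1) div 3) = L ^ 2] (mod int p)"
proof -
  have 3: "3 dvd p - 1" using exponent_exact[OF d(1) p(1,3) xy] .
  have "3 * ((p ^ 2 - 1) div 3) = 3 * ((p - 1) div 3 * (p + 1))"
    unfolding prime_square_minus_1_eq[OF p(1) p_neq_3] using 3 by (metis dvd_mult_div_cancel mult.assoc)
  then have "(p ^ 2 - 1) div 3 = (p - 1) div 3 * (p + 1)" by simp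
  then have "eps ^ ((p ^ 2 - 1) div 3) = L ^ (p + 1)" by (simp only: L_def power_mult)
  also have "p + 1 = (p - 1) + 2" using p_gt by simp
  also have "L ^ \<dots> = L ^ (p - 1) * L ^ 2" by (rule power_add)
  also have "[\<dots> = 1 * L ^ 2] (mod int p)"
  proof -
    have "\<not> int p dvd L" unfolding L_def using not_p_dvd_eps prime_int prime_dvd_power by blast
    then show ?thesis by (intro cong_mult cong_refl fermat_int p)
  qed
  finally show ?thesis by simp
qed

text \<open>With \<epsilon>' = 1/\<epsilon>, k^3 times the norm form product is (2\<epsilon>)^2
  (2\<epsilon>') = 8\<epsilon>, so the symbol is that of \<epsilon> and equals L^2; squaring returns
  L and flips the exponent. Since A^2 - d B^2 divides 4, it has no odd prime factors, and 3 cannot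
  divide d because it divides m.\<close>

lemma unit_power_direct:
  assumes AB: "m = A * k" "n = B * k" "coprime A B" "3 dvd A" "\<not> 9 dvd A"
  shows "[L = w ^ nat (A div 3 * B mod 3)] (mod int p)"
proof -
  define e where "e = (p ^ 2 - 1) div 3"
  define K where "K = nat ((- (A div 3 * B)) mod 3)"
  have D: "k ^ 2 * (A ^ 2 - d * B ^ 2) = 4"
    using mn unfolding AB by (simp add: power2_eq_square algebra_simps)
  have "3 dvd m" using AB by simp
  then have "\<not> 3 dvd d"
  proof (intro notI)
    assume "3 dvd m" "3 dvd d"
    then have "3 dvd m ^ 2 - d * n ^ 2" by (intro dvd_diff) (auto simp: power2_eq_square)
    then show False unfolding mn by simp
  qed
  have "[((A + B * s) ^ 2 * (A - B * s)) ^ e =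
      w ^ nat ((if 3 dvd d then A div 3 * B else - (A div 3 * B)) mod 3)] (mod int p)"
    unfolding e_def
  proof (intro norm_form_power AB)
    show "A ^ 2 - d * B ^ 2 \<noteq> 0" using D by auto
    fix l assume l: "prime l" "l \<noteq> 2" "int l dvd A ^ 2 - d * B ^ 2"
    then have "int l dvd k ^ 2 * (A ^ 2 - d * B ^ 2)" by simp
    then have "int l dvd 2 ^ 2" unfolding D by simp
    then show "int l dvd A" using l primes_dvd_imp_eq[of "int l" 2] prime_dvd_power[of "int l" 2 2] by auto
  qed
  then have W: "[((A + B * s) ^ 2 * (A - B * s)) ^ e = w ^ K] (mod int p)"
    using \<open>\<not> 3 dvd d\<close> by (simp add: K_def)
  have kP: "[k * (A + B * s) = 2 * eps] (mod int p)" "[k * (A - B * s) = 2 * eps'] (mod int p)"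
    using two_eps by (simp_all add: AB cong_sym algebra_simps)
  have k: "\<not> int p dvd k" using p(2) AB by auto
  have "k ^ 3 * ((A + B * s) ^ 2 * (A - B * s)) = (k * (A + B * s)) ^ 2 * (k * (A - B * s))"
    by (simp add: power2_eq_square power3_eq_cube)
  also have "[\<dots> = (2 * eps) ^ 2 * (2 * eps')] (mod int p)" by (intro cong_mult cong_pow kP)
  also have "(2 * eps) ^ 2 * (2 * eps') = 2 ^ 3 * eps * (eps * eps')" by (simp add: power2_eq_square)
  also have "[\<dots> = 2 ^ 3 * eps * 1] (mod int p)" by (intro cong_mult eps_mult cong_refl)
  finally have "[(k ^ 3) ^ e * ((A + B * s) ^ 2 * (A - B * s)) ^ e = (2 ^ 3) ^ e * eps ^ e] (mod int p)"
    unfolding power_mult_distrib[symmetric] by (intro cong_pow) simp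
  moreover have "[(k ^ 3) ^ e = 1] (mod int p)" "[(2 ^ 3) ^ e = 1] (mod int p)"
    unfolding e_def using k not_p_dvd by (intro cube_power_cong_1 p p_neq_3; simp)+
  ultimately have "[((A + B * s) ^ 2 * (A - B * s)) ^ e = eps ^ e] (mod int p)"
    by (rule cong_cancel_units)
  then have "[w ^ K = L ^ 2] (mod int p)"
    using W eps_power unfolding e_def by (meson cong_sym cong_trans)
  then have *: "[L ^ 2 = w ^ K] (mod int p)" by (rule cong_sym)
  have "[1 * L = L ^ 3 * L] (mod int p)" by (rule cong_sym[OF cong_mult[OF L_cube cong_refl]])
  also have "L ^ 3 * L = L ^ 2 * L ^ 2" by (simp add: power2_eq_square power3_eq_cube)
  also have "[L ^ 2 * L ^ 2 = w ^ K * w ^ K] (mod int p)" by (rule cong_mult[OF * *])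
  finally have "[L = w ^ K * w ^ K] (mod int p)" by simp
  also have "w ^ K * w ^ K = w ^ (2 * K)" by (simp flip: power_add add: mult_2)
  also have "[w ^ (2 * K) = w ^ nat (A div 3 * B mod 3)] (mod int p)"
  proof (intro w_power_cong cong_nat_mod_3)
    have "2 * (- X mod 3) mod 3 = X mod 3" for X :: int by presburger
    then show "[int (2 * K) = A div 3 * B] (mod 3)" by (simp add: K_def cong_def)
  qed
  finally show ?thesis .
qed

text \<open>The product of \<epsilon> + \<sigma> and its conjugate is \<sigma> (m + 2\<sigma>), and
  m + 2\<sigma> divides d n^2, which is prime to p.\<close>

lemma not_p_dvd_eps_add:
  assumes "\<sigma> = 1 \<or> \<sigma> = -1"
  shows "\<not> int p dvd eps + \<sigma>"
proof
  assume "int p dvd eps + \<sigma>"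
  then have "int p dvd 2 * ((eps + \<sigma>) * (eps' + \<sigma>))" by simp
  also have "2 * ((eps + \<sigma>) * (eps' + \<sigma>)) = 2 * (eps * eps') + \<sigma> * (2 * eps) + \<sigma> * (2 * eps') + 2 * \<sigma> ^ 2"
    by (simp add: power2_eq_square algebra_simps)
  finally have *: "int p dvd \<dots>" .
  have "[2 * (eps * eps') + \<sigma> * (2 * eps) + \<sigma> * (2 * eps') + 2 * \<sigma> ^ 2 =
      2 * 1 + \<sigma> * (m + n * s) + \<sigma> * (m - n * s) + 2 * \<sigma> ^ 2] (mod int p)"
    by (intro cong_add cong_mult eps_mult two_eps cong_refl)
  with * have "int p dvd 2 * 1 + \<sigma> * (m + n * s) + \<sigma> * (m - n * s) + 2 * \<sigma> ^ 2"
    using cong_dvd_iff by blast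
  also have "\<dots> = 2 * \<sigma> * (m + 2 * \<sigma>)" using assms by (auto simp: algebra_simps)
  finally have "int p dvd 2 * \<sigma> * (m + 2 * \<sigma>) * (m - 2 * \<sigma>)" by simp
  also have "\<dots> = 2 * \<sigma> * (m ^ 2 - 4)" using assms by (auto simp: power2_eq_square algebra_simps)
  also have "m ^ 2 - 4 = d * n ^ 2" using mn by simp
  finally have "int p dvd \<sigma>"
    using p(2) not_p_dvd by (simp add: p_dvd_mult_iff p_dvd_power2_iff)
  then show False using assms p_gt by auto
qed

text \<open>As \<epsilon>(\<epsilon>' + \<sigma>) = \<sigma>(\<epsilon> + \<sigma>), multiplying the
  norm form product by k^3 \<epsilon> gives the cube of 2\<sigma>(\<epsilon> + \<sigma>). The
  product therefore represents the inverse of \<epsilon>, and the exponent appears without a flip.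
  The relation k (A^2 - d B^2) = 4\<sigma>A forces its odd primes into A.\<close>

lemma unit_power_shifted:
  assumes \<sigma>: "\<sigma> = 1 \<or> \<sigma> = -1"
    and AB: "m + 2 * \<sigma> = A * k" "n = B * k" "coprime A B" "3 dvd A" "\<not> 9 dvd A"
  shows "[L = w ^ nat ((if 3 dvd d then A div 3 * B else - (A div 3 * B)) mod 3)] (mod int p)"
proof -
  define e where "e = (p ^ 2 - 1) div 3"
  define K where "K = nat ((if 3 dvd d then A div 3 * B else - (A div 3 * B)) mod 3)"
  have k0: "k \<noteq> 0" using n AB by auto
  have "k * (k * (A ^ 2 - d * B ^ 2)) = (m + 2 * \<sigma>) ^ 2 - d * n ^ 2"
    unfolding AB by (simp add: power2_eq_square algebra_simps)
  also have "\<dots> = 4 * \<sigma> * (m + 2 * \<sigma>)"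
    using mn \<sigma> by (auto simp: power2_eq_square algebra_simps)
  also have "\<dots> = k * (4 * \<sigma> * A)" unfolding AB by simp
  finally have D: "k * (A ^ 2 - d * B ^ 2) = 4 * \<sigma> * A" using k0 by simp
  have W: "[((A + B * s) ^ 2 * (A - B * s)) ^ e = w ^ K] (mod int p)"
    unfolding e_def K_def
  proof (intro norm_form_power AB)
    show "A ^ 2 - d * B ^ 2 \<noteq> 0" using D \<sigma> AB by auto
    fix l assume l: "prime l" "l \<noteq> 2" "int l dvd A ^ 2 - d * B ^ 2"
    then have "int l dvd k * (A ^ 2 - d * B ^ 2)" by simp
    then have "int l dvd 4 * A" unfolding D using \<sigma> by auto
    then have "int l dvd 2 ^ 2 \<or> int l dvd A" using l(1) prime_dvd_multD[of "int l" 4 A] by simp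
    moreover have "\<not> int l dvd 2" using l primes_dvd_imp_eq[of "int l" 2] by auto
    ultimately show "int l dvd A" using l(1) prime_dvd_power[of "int l" 2 2] by auto
  qed
  have kP: "[k * (A + B * s) = 2 * (eps + \<sigma>)] (mod int p)"
  proof -
    have "k * (A + B * s) = (m + n * s) + 2 * \<sigma>" using AB(1) by (simp add: AB(2) algebra_simps)
    also have "[\<dots> = 2 * eps + 2 * \<sigma>] (mod int p)" by (intro cong_add cong_sym[OF two_eps(1)] cong_refl)
    finally show ?thesis by simp
  qed
  have kM: "[eps * (k * (A - B * s)) = 2 * \<sigma> * (eps + \<sigma>)] (mod int p)"
  proof -
    have "k * (A - B * s) = (m - n * s) + 2 * \<sigma>" using AB(1) by (simp add: AB(2) algebra_simps)
    also have "[\<dots> = 2 * eps' + 2 * \<sigma>] (mod int p)" by (intro cong_add cong_sym[OF two_eps(2)] cong_refl)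
    finally have "[eps * (k * (A - B * s)) = eps * (2 * eps' + 2 * \<sigma>)] (mod int p)"
      by (intro cong_mult cong_refl)
    also have "eps * (2 * eps' + 2 * \<sigma>) = 2 * (eps * eps') + 2 * \<sigma> * eps" by (simp add: algebra_simps)
    also have "[\<dots> = 2 * 1 + 2 * \<sigma> * eps] (mod int p)" by (intro cong_add cong_mult eps_mult cong_refl)
    also have "2 * 1 + 2 * \<sigma> * eps = 2 * \<sigma> * (eps + \<sigma>)" using \<sigma> by (auto simp: algebra_simps)
    finally show ?thesis .
  qed
  have k: "\<not> int p dvd k" using p(2) AB by auto
  have "k ^ 3 * (eps * ((A + B * s) ^ 2 * (A - B * s))) = (k * (A + B * s)) ^ 2 * (eps * (k * (A - B * s)))"
    by (simp add: power2_eq_square power3_eq_cube)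
  also have "[\<dots> = (2 * (eps + \<sigma>)) ^ 2 * (2 * \<sigma> * (eps + \<sigma>))] (mod int p)"
    by (intro cong_mult cong_pow kP kM)
  also have "(2 * (eps + \<sigma>)) ^ 2 * (2 * \<sigma> * (eps + \<sigma>)) = (2 * \<sigma> * (eps + \<sigma>)) ^ 3"
  proof -
    have "(2 * c) ^ 2 * (2 * \<sigma> * c) = (2 * \<sigma> * c) ^ 3" for c
      using \<sigma> by (auto simp: power2_eq_square power3_eq_cube)
    then show ?thesis .
  qed
  finally have "[(k ^ 3) ^ e * (eps ^ e * ((A + B * s) ^ 2 * (A - B * s)) ^ e) = ((2 * \<sigma> * (eps + \<sigma>)) ^ 3) ^ e] (mod int p)"
    unfolding power_mult_distrib[symmetric] by (rule cong_pow)
  then have "[(k ^ 3) ^ e * (eps ^ e * ((A + B * s) ^ 2 * (A - B * s)) ^ e) = ((2 * \<sigma> * (eps + \<sigma>)) ^ 3) ^ e * 1] (mod int p)"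
    by simp
  moreover have "[(k ^ 3) ^ e = 1] (mod int p)"
    unfolding e_def using k by (intro cube_power_cong_1 p p_neq_3)
  moreover have "[((2 * \<sigma> * (eps + \<sigma>)) ^ 3) ^ e = 1] (mod int p)"
    unfolding e_def
  proof (intro cube_power_cong_1 p p_neq_3)
    have "\<not> int p dvd \<sigma>" using \<sigma> p_gt by auto
    then show "\<not> int p dvd 2 * \<sigma> * (eps + \<sigma>)"
      using not_p_dvd not_p_dvd_eps_add[OF \<sigma>] by (simp add: p_dvd_mult_iff)
  qed
  ultimately have *: "[eps ^ e * ((A + B * s) ^ 2 * (A - B * s)) ^ e = 1] (mod int p)"
    by (rule cong_cancel_units)
  have "[L ^ 2 * w ^ K = eps ^ e * ((A + B * s) ^ 2 * (A - B * s)) ^ e] (mod int p)"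
    by (intro cong_mult cong_sym[OF W] cong_sym[OF eps_power[folded e_def]])
  also note *
  finally have "[L ^ 2 * w ^ K = 1] (mod int p)" .
  then have "[L * (L ^ 2 * w ^ K) = L * 1] (mod int p)" by (intro cong_mult cong_refl)
  moreover have "L * (L ^ 2 * w ^ K) = L ^ 3 * w ^ K" by (simp add: power2_eq_square power3_eq_cube)
  moreover have "[L ^ 3 * w ^ K = 1 * w ^ K] (mod int p)" by (intro cong_mult L_cube cong_refl)
  ultimately have "[L = w ^ K] (mod int p)" by (simp, meson cong_sym cong_trans)
  then show ?thesis by (simp add: K_def)
qed

text \<open>Both w and w^2 are (-1 + t)/2 up to the sign of t, and the Legendre symbol of the
  exponent is that sign.\<close>

lemma w_power_Legendre:
  assumes "\<not> 3 dvd T" "[L = w ^ nat (T mod 3)] (mod int p)"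
  shows "[L = half * (- 1 + Legendre T 3 * t)] (mod int p)"
proof -
  have "T mod 3 = 1 \<or> T mod 3 = 2" using assms(1) by presburger
  then show ?thesis
  proof
    assume T: "T mod 3 = 1"
    then show ?thesis using assms(2) by (simp add: Legendre_3 w_def)
  next
    assume T: "T mod 3 = 2"
    then have "[L = w ^ 2] (mod int p)" using assms(2) by simp
    then have "[L = half * (- 1 - t)] (mod int p)" using w_square cong_sym cong_trans by blast
    then show ?thesis using T by (simp add: Legendre_3)
  qed
qed

end

section \<open>The residue classes of m\<close>

lemma Legendre_3_cong: "[a = b] (mod 3) \<Longrightarrow> Legendre a 3 = Legendre b 3"
  by (simp add: Legendre_3 cong_def)

lemma Legendre_3_minus: "Legendre (- a) 3 = - Legendre a 3"
proof -
  have "a mod 3 = 0 \<or> a mod 3 = 1 \<or> a mod 3 = 2" by presburger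
  then show ?thesis
  proof (elim disjE)
    assume "a mod 3 = 0"
    moreover from this have "- a mod 3 = 0" by presburger
    ultimately show ?thesis by (simp add: Legendre_3)
  next
    assume "a mod 3 = 1"
    moreover from this have "- a mod 3 = 2" by presburger
    ultimately show ?thesis by (simp add: Legendre_3)
  next
    assume "a mod 3 = 2"
    moreover from this have "- a mod 3 = 1" by presburger
    ultimately show ?thesis by (simp add: Legendre_3)
  qed
qed

lemma cong_int_obtain:
  assumes "[m = a] (mod k)"
  obtains j where "m = a + k * (j::int)"
proof -
  obtain j where "m - a = k * j" using assms by (auto simp: cong_iff_dvd_diff elim: dvdE)
  then show ?thesis using that[of j] by (simp add: algebra_simps)
qed

lemma residues_mod_9:
  assumes "[m = 5] (mod 9) \<or> [m = 8] (mod (9::int))"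
  shows "3 dvd m - 2 \<and> \<not> 9 dvd m - 2 \<and> \<not> 3 dvd m + 2"
  using assms
proof (elim disjE)
  assume "[m = 5] (mod 9)"
  then obtain j where "m = 5 + 9 * j" by (rule cong_int_obtain)
  then show ?thesis by presburger
next
  assume "[m = 8] (mod 9)"
  then obtain j where "m = 8 + 9 * j" by (rule cong_int_obtain)
  then show ?thesis by presburger
qed

lemma residues_mod_27:
  assumes "[m = 11] (mod 27) \<or> [m = 20] (mod (27::int))"
  shows "9 dvd m - 2 \<and> \<not> 27 dvd m - 2 \<and> \<not> 3 dvd m + 2"
  using assms
proof (elim disjE)
  assume "[m = 11] (mod 27)"
  then obtain j where "m = 11 + 27 * j" by (rule cong_int_obtain)
  then show ?thesis by presburger
next
  assume "[m = 20] (mod 27)"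
  then obtain j where "m = 20 + 27 * j" by (rule cong_int_obtain)
  then show ?thesis by presburger
qed
theorem theorem8p2:
  fixes d m n x y s :: int and p :: nat
  assumes "d > 1" and "squarefree d"
    and "m \<noteq> 0" and "n \<noteq> 0"
    and "m ^ 2 - d * n ^ 2 = 4"
    and "\<not> 9 dvd m" and "\<not> 27 dvd (m - 2)"
    and "multiplicity 3 (m - 2) \<ge> multiplicity 3 n"
    and "prime p" and "\<not> int p dvd n"
    and "int p = x ^ 2 + 3 * d * y ^ 2"
    and "\<not> 3 dvd y" and "[x = y] (mod 3)"
    and "[s ^ 2 = d] (mod int p)"
  shows "let half = modular_inverse (int p) 2;
             L = ((m + n * s) * half) ^ ((p - 1) div 3);
             r = x * modular_inverse (int p) (d * y) * s
         in ([m = 5] (mod 9) \<or> [m = 8] (mod 9) \<longrightarrow>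
              [L = half * (- 1 + Legendre ((m - 2) * n div 3) 3 * r)] (mod int p)) \<and>
            ([m = 11] (mod 27) \<or> [m = 20] (mod 27) \<longrightarrow>
              [L = half * (- 1 - Legendre ((m - 2) * n div 27) 3 * r)] (mod int p)) \<and>
            ([m = 0] (mod 3) \<longrightarrow>
              [L = half * (- 1 + Legendre (m * n div 3) 3 * r)] (mod int p)) \<and>
            ([m = 1] (mod 3) \<longrightarrow>
              [L = half * (- 1 + Legendre ((m + 2) * n div 3) 3 * r)] (mod int p))"
proof -
  define half where "half = modular_inverse (int p) 2"
  define r where "r = x * modular_inverse (int p) (d * y) * s"
  have cop: "coprime 2 (int p)" "coprime (d * y) (int p)"
    using denominators_coprime assms by blast+
  interpret unit_power d m n x y s half r p
  proof
    show "[2 * half = 1] (mod int p)" unfolding half_def by (rule cong_modular_inverse1[OF cop(1)])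
    have "[d * y * modular_inverse (int p) (d * y) * (x * s) = 1 * (x * s)] (mod int p)"
      by (intro cong_mult cong_modular_inverse1 cop cong_refl)
    then show "[d * y * r = x * s] (mod int p)" by (simp add: r_def ac_simps)
  qed (use assms in auto)
  have prime3: "prime (3::int)" by simp
  have n3: "3 dvd n" if "9 dvd d * n ^ 2"
  proof (rule ccontr)
    assume "\<not> 3 dvd n"
    then have "coprime (3 ^ 2) (n ^ 2)"
      using prime_imp_coprime[OF prime3] by (simp only: coprime_power_left_iff coprime_power_right_iff) simp
    then have "9 dvd d" using that coprime_dvd_mult_left_iff[of 9 "n ^ 2" d] by simp
    then show False using not_9_dvd by simp
  qed
  have T: "\<not> 3 dvd A div 3 * B" "[k ^ 2 * (A div 3 * B) = A div 3 * B] (mod 3)"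
    if "coprime A B" "3 dvd A" "\<not> 9 dvd A" "\<not> 3 dvd k" for A B k :: int
  proof -
    obtain A3 where A3: "A = 3 * A3" using \<open>3 dvd A\<close> by (elim dvdE)
    have "\<not> 3 dvd A3" using that(3) A3 by auto
    moreover have "\<not> 3 dvd B" using coprime_common_divisor[OF that(1,2)] by auto
    ultimately show "\<not> 3 dvd A div 3 * B" using prime_dvd_multD[OF prime3] A3 by auto
    show "[k ^ 2 * (A div 3 * B) = A div 3 * B] (mod 3)"
      using cong_mult[OF square_cong_1_mod_3[OF that(4)] cong_refl] by simp
  qed
  have mn': "(m - 2) * (m + 2) = d * n ^ 2" using mn by (simp add: power2_eq_square algebra_simps)
  \<comment> \<open>When 3 does not divide n, the common factor k is prime to 3. So A keeps the
    single factor 3 of M, and M n / 3 differs from (A/3) B only by the square k^2.\<close>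
  have simple: "\<exists>A B k. M = A * k \<and> n = B * k \<and> coprime A B \<and> 3 dvd A \<and> \<not> 9 dvd A \<and> \<not> 3 dvd k
      \<and> Legendre (M * n div 3) 3 = Legendre (A div 3 * B) 3"
    if M: "3 dvd M" "\<not> 9 dvd M" "\<not> 3 dvd n" for M
  proof -
    have "gcd M n \<noteq> 0" using n by simp
    then obtain A B where AB: "M = A * gcd M n" "n = B * gcd M n" "coprime A B"
      using gcd_coprime_exists by metis
    define k where "k = gcd M n"
    have k: "\<not> 3 dvd k" using M(3) by (simp add: k_def)
    have "3 dvd A" using M(1) k AB(1) prime_dvd_multD[OF prime3, of A k] by (simp add: k_def)
    moreover have "\<not> 9 dvd A" using M(2) AB(1) by (metis dvd_mult2)
    moreover have "M * n div 3 = k ^ 2 * (A div 3 * B)"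
    proof -
      obtain A3 where "A = 3 * A3" using \<open>3 dvd A\<close> by (elim dvdE)
      moreover have "M = A * k" "n = B * k" using AB by (simp_all add: k_def)
      ultimately show ?thesis by (simp add: power2_eq_square)
    qed
    ultimately show ?thesis
      using AB k T(2)[of A B k] Legendre_3_cong unfolding k_def[symmetric] by metis
  qed
  have shifted: "[L = half * (- 1 + Legendre ((m + 2 * \<sigma>) * n div 3) 3 * r)] (mod int p)"
    if \<sigma>: "\<sigma> = 1 \<or> \<sigma> = -1" and M: "3 dvd m + 2 * \<sigma>" "\<not> 9 dvd m + 2 * \<sigma>" "\<not> 3 dvd n" for \<sigma>
  proof -
    obtain A B k where AB: "m + 2 * \<sigma> = A * k" "n = B * k" "coprime A B" "3 dvd A" "\<not> 9 dvd A" "\<not> 3 dvd k"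
      and Leg: "Legendre ((m + 2 * \<sigma>) * n div 3) 3 = Legendre (A div 3 * B) 3"
      using simple[OF M] by blast
    \<comment> \<open>The product is d n^2, so 3 passes to d, which selects the positive sign in the
      exponent.\<close>
    have "3 dvd (m + 2 * \<sigma>) * (m - 2 * \<sigma>)" using M(1) by simp
    also have "\<dots> = d * n ^ 2" using mn' \<sigma> by (auto simp: algebra_simps)
    finally have "3 dvd d"
      using M(3) prime_dvd_multD[OF prime3] prime_dvd_power[OF prime3] by blast
    then have "[L = w ^ nat (A div 3 * B mod 3)] (mod int p)"
      using unit_power_shifted[OF \<sigma> AB(1-5)] by simp
    then show ?thesis unfolding Leg by (rule w_power_Legendre[OF T(1)[OF AB(3-6)]])
  qed
  have "[L = half * (- 1 + Legendre ((m - 2) * n div 3) 3 * r)] (mod int p)"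
    if "[m = 5] (mod 9) \<or> [m = 8] (mod 9)"
  proof -
    have m: "3 dvd m - 2" "\<not> 9 dvd m - 2" "\<not> 3 dvd m + 2"
      using residues_mod_9[OF that] by auto
    \<comment> \<open>A factor 3 of n would put 9 into (m - 2)(m + 2), hence into m - 2, as 3 does
      not divide m + 2.\<close>
    have "\<not> 3 dvd n"
    proof
      assume "3 dvd n"
      then have "3 ^ 2 dvd d * n ^ 2" by (intro dvd_mult dvd_power_same)
      then have "9 dvd (m - 2) * (m + 2)" unfolding mn' by simp
      moreover have "coprime (3 ^ 2) (m + 2)"
        using m(3) prime_imp_coprime[OF prime3] by (simp only: coprime_power_left_iff) simp
      ultimately show False using m(2) coprime_dvd_mult_left_iff[of 9 "m + 2" "m - 2"] by simp
    qed
    then show ?thesis using shifted[of "-1"] m by simp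
  qed
  moreover have "[L = half * (- 1 + Legendre ((m + 2) * n div 3) 3 * r)] (mod int p)"
    if "[m = 1] (mod 3)"
  proof -
    have m: "3 dvd m + 2" "\<not> 3 dvd m - 2" using that unfolding cong_def by presburger+
    \<comment> \<open>The comparison of 3-adic orders excludes 3 from n here, and then 9 cannot
      divide m + 2.\<close>
    then have "multiplicity 3 (m - 2) = 0" by (simp add: not_dvd_imp_multiplicity_0)
    then have n3': "\<not> 3 dvd n"
      using assms(8) n prime_multiplicity_gt_zero_iff[of "3::int" n] by auto
    moreover have "\<not> 9 dvd m + 2"
    proof
      assume "9 dvd m + 2"
      then have "9 dvd d * n ^ 2" unfolding mn'[symmetric] by simp
      then show False using n3 n3' by blast
    qed
    ultimately show ?thesis using shifted[of 1] m by simp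
  qed
  moreover have "[L = half * (- 1 + Legendre (m * n div 3) 3 * r)] (mod int p)"
    if "[m = 0] (mod 3)"
  proof -
    have m: "3 dvd m" using that by (simp add: cong_0_iff)
    have "\<not> 3 dvd n"
    proof
      assume "3 dvd n"
      then have "3 dvd m ^ 2 - d * n ^ 2" using m by (intro dvd_diff) (auto simp: power2_eq_square)
      then show False unfolding mn by simp
    qed
    then obtain A B k where AB: "m = A * k" "n = B * k" "coprime A B" "3 dvd A" "\<not> 9 dvd A" "\<not> 3 dvd k"
      and Leg: "Legendre (m * n div 3) 3 = Legendre (A div 3 * B) 3"
      using simple[OF m assms(6)] by blast
    show ?thesis unfolding Leg
      by (rule w_power_Legendre[OF T(1)[OF AB(3-6)] unit_power_direct[OF AB(1-5)]])
  qed
  moreover have "[L = half * (- 1 - Legendre ((m - 2) * n div 27) 3 * r)] (mod int p)"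
    if "[m = 11] (mod 27) \<or> [m = 20] (mod 27)"
  proof -
    have m: "9 dvd m - 2" "\<not> 27 dvd m - 2" "\<not> 3 dvd m + 2"
      using residues_mod_27[OF that] by auto
    \<comment> \<open>The product (m - 2)(m + 2) = d n^2 has 3-adic order exactly 2 and 9 does not
      divide d, so n has order 1 and d order 0. The ratio of m - 2 to n still has one factor 3, and
      the exponent is negated because 3 does not divide d.\<close>
    have "9 dvd d * n ^ 2" unfolding mn'[symmetric] using m(1) by simp
    then have "3 dvd n" by (rule n3)
    then obtain n1 where n1: "n = 3 * n1" by (elim dvdE)
    obtain m1 where m1: "m - 2 = 9 * m1" using m(1) by (elim dvdE)
    have m1': "\<not> 3 dvd m1" using m(2) m1 by auto
    have "m1 * (m + 2) = d * n1 ^ 2" using mn' unfolding m1 n1 by (simp add: power2_eq_square)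
    moreover have "\<not> 3 dvd m1 * (m + 2)" using m1' m(3) prime_dvd_multD[OF prime3] by blast
    ultimately have "\<not> 3 dvd d" "\<not> 3 dvd n1" by (auto simp: power2_eq_square)
    have M: "3 dvd 3 * m1" "\<not> 9 dvd 3 * m1" using m1' by auto
    have "gcd (3 * m1) n1 \<noteq> 0" using n n1 by simp
    then obtain A B where AB: "3 * m1 = A * gcd (3 * m1) n1" "n1 = B * gcd (3 * m1) n1" "coprime A B"
      using gcd_coprime_exists by metis
    define k where "k = gcd (3 * m1) n1"
    have k: "\<not> 3 dvd k" using \<open>\<not> 3 dvd n1\<close> by (simp add: k_def)
    have A: "3 dvd A" using M(1) k AB(1) prime_dvd_multD[OF prime3, of A k] by (simp add: k_def)
    have A9: "\<not> 9 dvd A" using M(2) AB(1) by (metis dvd_mult2)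
    have eq: "m + 2 * (-1) = A * (3 * k)" "n = B * (3 * k)"
      using AB m1 n1 by (simp_all add: k_def)
    have "[L = w ^ nat (- (A div 3 * B) mod 3)] (mod int p)"
      using unit_power_shifted[OF _ eq AB(3) A A9] \<open>\<not> 3 dvd d\<close> by simp
    then have "[L = half * (- 1 + Legendre (- (A div 3 * B)) 3 * r)] (mod int p)"
      using T(1)[OF AB(3) A A9 k] by (intro w_power_Legendre) auto
    \<comment> \<open>The 27 is accounted for by one factor 3 each in the common factor 3k of m - 2
      and of n, and one in A.\<close>
    moreover have "(m - 2) * n div 27 = k ^ 2 * (A div 3 * B)"
    proof -
      obtain A3 where "A = 3 * A3" using A by (elim dvdE)
      moreover have "m - 2 = A * (3 * k)" using eq(1) by simp
      ultimately show ?thesis by (simp add: eq(2) power2_eq_square)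
    qed
    then have "Legendre ((m - 2) * n div 27) 3 = Legendre (A div 3 * B) 3"
      using Legendre_3_cong T(2)[OF AB(3) A A9 k] by metis
    ultimately show ?thesis by (simp add: Legendre_3_minus)
  qed
  ultimately show ?thesis
    unfolding Let_def half_def[symmetric] r_def[symmetric] eps_def[symmetric] L_def[symmetric] by blast
qed

end
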